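(* Let $\mu$ be a non-atomic finite positive measure on a measurable space $(\Omega,\Sigma)$, let $L^2$ be a Hilbert space, $1\le p<\infty$ and $\sigma=1/p'$, where $1/p+1/p'=1$. Let $u:L^2\to L^2$ be a $2p$-approximable operator. Then the composition operator $\tilde u:\mathcal P_p^\sigma(\mu,L^2)\to\mathcal B_p(\mu,L^2)$, $\tilde u(f)=u\circ f$, is well defined and continuous.
   Context: A continuous linear operator $u$ is $r$-approximable ($1\le r<\infty$) if its sequence of approximation numbers $a_n(u)=\inf\{\|u-v\|:\operatorname{rank}v<n\}$ belongs to $\ell_r$ (on Hilbert spaces: the Schatten $r$-class). For $1\le p<\infty$ and a Banach space $X$, $\mathcal P_p(\mu,X)$ is the space of ($\mu$-a.e. classes of) strongly measurable Pettis $p$-integrable functions $f:\Omega\to X$ (Pettis integrable with $x'\circ f\in L^p(\mu)$ for all $x'\in X^*$) with norm $\|f\|_{\mathcal P_p}=\sup_{x'\in B_{X^*}}(\int|x'(f(w))|^p\,d\mu(w))^{1/p}$. $\mathcal B_p(\mu,X)$ is the space of Bochner $p$-integrable functions $f:\Omega\to X$ with norm $(\int\|f(w)\|^p\,d\mu(w))^{1/p}$. For $1\le p<\infty$, $0\le\sigma\le1$ let $\mathcal S_p^\sigma(\mu,X)$ be the space of $\mu$-classes of $X$-valued simple functions. For such $f$ put $$\Phi_{p,\sigma}(f)=\sup_{x'\in B_{X^*}}\Big(\int\big(|\langle f(w),x'\rangle|^{1-\sigma}\|f(w)\|^\sigma\big)^p\,d\mu(w)\Big)^{1/p}$$ and $\|f\|_{p,\sigma}=\inf\{\sum_{i=1}^n\Phi_{p,\sigma}(f_i):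 f=\sum_{i=1}^n f_i,\ f_i\in\mathcal S_p^\sigma(\mu,X)\}$. This is a norm with $\|\cdot\|_{\mathcal P_p}\le\|\cdot\|_{p,\sigma}$. Define $\mathcal P_p^\sigma(\mu,X):=\overline{\mathcal S_p^\sigma(\mu,X)}\cap\mathcal P_p(\mu,X)$, where $\overline{\mathcal S_p^\sigma(\mu,X)}$ is the completion for $\|\cdot\|_{p,\sigma}$, with the norm induced by that completion; concretely, it consists of those $f\in\mathcal P_p(\mu,X)$ for which there is a $\|\cdot\|_{p,\sigma}$-Cauchy sequence $(f_n)$ of simple functions converging to $f$ in $\|\cdot\|_{\mathcal P_p}$, and the norm of $f$ is the infimum of $\lim_n\|f_n\|_{p,\sigma}$ over such sequences. "Well defined" means $u\circ f\in\mathcal B_p(\mu,L^2)$ for every $f$ in the domain. *)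

theory Defs
  imports "HOL-Analysis.Analysis"
begin

definition nonatomic :: "'w measure \<Rightarrow> bool" where
  "nonatomic M \<longleftrightarrow> (\<forall>A\<in>sets M. 0 < emeasure M A \<longrightarrow>
     (\<exists>B\<in>sets M. B \<subseteq> A \<and> 0 < emeasure M B \<and> emeasure M B < emeasure M A))"

(* dim is 0 for infinite-dimensional spaces, so finite dimension is demanded separately. *)
definition rank_less :: "('a::real_normed_vector \<Rightarrow>\<^sub>L 'b::real_normed_vector) \<Rightarrow> nat \<Rightarrow> bool" where
  "rank_less v n \<longleftrightarrow> (\<exists>B. finite B \<and> range (blinfun_apply v) \<subseteq> span B) \<and>
     dim (range (blinfun_apply v)) < n"

definition approx_number :: "('a::real_normed_vector \<Rightarrow>\<^sub>L 'b::real_normed_vector) \<Rightarrow> nat \<Rightarrow> real" where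
  "approx_number u n = Inf {norm (u - v) | v. rank_less v n}"

(* Approximation numbers are indexed from 1. *)
definition approximable :: "real \<Rightarrow> ('a::real_normed_vector \<Rightarrow>\<^sub>L 'b::real_normed_vector) \<Rightarrow> bool" where
  "approximable r u \<longleftrightarrow> summable (\<lambda>n. approx_number u (Suc n) powr r)"

(* The function spaces below consist of functions rather than of a.e. classes, and their norms
   are seminorms. Strong measurability asks for convergence at every point: a function that is
   only an a.e. limit of simple functions agrees a.e. with one of this kind, so the a.e. classes
   are the usual ones. The library's Bochner integral needs second countability of the range,
   which is not assumed here. *)
definition strongly_measurable :: "'w measure \<Rightarrow> ('w \<Rightarrow> 'a::real_normed_vector) \<Rightarrow> bool" where
  "strongly_measurable M f \<longleftrightarrow> (\<exists>s. (\<forall>n. simple_function M (s n)) \<and>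
     (\<forall>w\<in>space M. (\<lambda>n. s n w) \<longlonglongrightarrow> f w))"

definition bochner_space :: "'w measure \<Rightarrow> real \<Rightarrow> ('w \<Rightarrow> 'a::real_normed_vector) set" where
  "bochner_space M p = {f. strongly_measurable M f \<and> integrable M (\<lambda>w. norm (f w) powr p)}"

definition bochner_norm :: "'w measure \<Rightarrow> real \<Rightarrow> ('w \<Rightarrow> 'a::real_normed_vector) \<Rightarrow> real" where
  "bochner_norm M p f = (\<integral>w. norm (f w) powr p \<partial>M) powr (1 / p)"

definition pettis_integrable :: "'w measure \<Rightarrow> ('w \<Rightarrow> 'a::real_normed_vector) \<Rightarrow> bool" where
  "pettis_integrable M f \<longleftrightarrow>
     (\<forall>x' :: 'a \<Rightarrow>\<^sub>L real. integrable M (\<lambda>w. x' (f w))) \<and>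
     (\<forall>A\<in>sets M. \<exists>x. \<forall>x' :: 'a \<Rightarrow>\<^sub>L real. x' x = set_lebesgue_integral M A (\<lambda>w. x' (f w)))"

definition pettis_space :: "'w measure \<Rightarrow> real \<Rightarrow> ('w \<Rightarrow> 'a::real_normed_vector) set" where
  "pettis_space M p = {f. strongly_measurable M f \<and> pettis_integrable M f \<and>
     (\<forall>x' :: 'a \<Rightarrow>\<^sub>L real. integrable M (\<lambda>w. \<bar>x' (f w)\<bar> powr p))}"

(* Taking the supremum in ennreal avoids presupposing that it is finite on pettis_space
   (which holds for Banach spaces by the closed graph theorem). *)
definition pettis_norm :: "'w measure \<Rightarrow> real \<Rightarrow> ('w \<Rightarrow> 'a::real_normed_vector) \<Rightarrow> ennreal" where
  "pettis_norm M p f =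
     (SUP x' \<in> cball (0 :: 'a \<Rightarrow>\<^sub>L real) 1. ennreal ((\<integral>w. \<bar>blinfun_apply x' (f w)\<bar> powr p \<partial>M) powr (1 / p)))"

(* For a finite measure and simple f this real supremum is over a bounded set. The convention
   0 powr 0 = 0 is harmless: for \<sigma> = 0 the product vanishes wherever f w = 0 anyway, and for
   \<sigma> = 1 some x' in the ball vanishes at none of the finitely many nonzero values of f. *)
definition Phi :: "'w measure \<Rightarrow> real \<Rightarrow> real \<Rightarrow> ('w \<Rightarrow> 'a::real_normed_vector) \<Rightarrow> real" where
  "Phi M p \<sigma> f = (SUP x' \<in> cball (0 :: 'a \<Rightarrow>\<^sub>L real) 1.
     (\<integral>w. (\<bar>blinfun_apply x' (f w)\<bar> powr (1 - \<sigma>) * norm (f w) powr \<sigma>) powr p \<partial>M) powr (1 / p))"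

definition simple_psigma_norm ::
    "'w measure \<Rightarrow> real \<Rightarrow> real \<Rightarrow> ('w \<Rightarrow> 'a::real_normed_vector) \<Rightarrow> real" where
  "simple_psigma_norm M p \<sigma> f = Inf {\<Sum>i<n. Phi M p \<sigma> (g i) | (n :: nat) g.
     (\<forall>i<n. simple_function M (g i)) \<and> (AE w in M. f w = (\<Sum>i<n. g i w))}"

definition psigma_approximating ::
    "'w measure \<Rightarrow> real \<Rightarrow> real \<Rightarrow> (nat \<Rightarrow> 'w \<Rightarrow> 'a::real_normed_vector) \<Rightarrow> ('w \<Rightarrow> 'a) \<Rightarrow> bool" where
  "psigma_approximating M p \<sigma> s f \<longleftrightarrow>
     (\<forall>n. simple_function M (s n)) \<and>
     (\<forall>\<epsilon>>0. \<exists>N. \<forall>m\<ge>N. \<forall>n\<ge>N. simple_psigma_norm M p \<sigma> (\<lambda>w. s m w - s n w) < \<epsilon>) \<and>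
     (\<lambda>n. pettis_norm M p (\<lambda>w. s n w - f w)) \<longlonglongrightarrow> 0"

definition psigma_space ::
    "'w measure \<Rightarrow> real \<Rightarrow> real \<Rightarrow> ('w \<Rightarrow> 'a::real_normed_vector) set" where
  "psigma_space M p \<sigma> = {f \<in> pettis_space M p. \<exists>s. psigma_approximating M p \<sigma> s f}"

definition psigma_norm ::
    "'w measure \<Rightarrow> real \<Rightarrow> real \<Rightarrow> ('w \<Rightarrow> 'a::real_normed_vector) \<Rightarrow> real" where
  "psigma_norm M p \<sigma> f = Inf {lim (\<lambda>n. simple_psigma_norm M p \<sigma> (s n)) | s.
     psigma_approximating M p \<sigma> s f}"

end

theory Submission
  imports Defs
begin

text \<open>Let \<open>\<sigma> = 1 - 1 / p\<close> and let \<open>f\<close> be simple, so that only the restriction of \<open>u\<close> to a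
  finite-dimensional subspace matters. Its singular values \<open>s\<^sub>i\<close>, with singular vectors \<open>e\<^sub>i\<close>, are
  bounded by the approximation numbers of \<open>u\<close>. Jensen's inequality gives
  \<open>norm (u x) powr p \<le> norm x powr (p - 1) * norm (T x)\<close>, where \<open>T = \<bar>u\<bar>\<^sup>p\<close> has singular values
  \<open>s\<^sub>i powr p\<close> and is Hilbert-Schmidt because \<open>u\<close> is \<open>2 * p\<close>-approximable. By Khinchine's inequality,
  \<open>norm (T x)\<close> is at most a constant times the average over signs of
  \<open>\<bar>x \<bullet> (\<Sum>i. \<plusminus> s\<^sub>i powr p *\<^sub>R e\<^sub>i)\<bar>\<close>, and these vectors have bounded norm. Integrating bounds the
  Bochner norm of \<open>u \<circ> f\<close> by a multiple of \<open>Phi f\<close>, and Minkowski's inequality turns \<open>Phi\<close> into the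
  \<open>(p, \<sigma>)\<close>-norm. For general \<open>f\<close>, Pettis convergence gives weak convergence almost everywhere along a
  subsequence, and Fatou's lemma with weak lower semicontinuity of the norm carries the bound over.\<close>

subsection \<open>Khinchine's inequality\<close>

lemma sum_Pow_insert:
  fixes g :: "'a set \<Rightarrow> 'b::comm_monoid_add"
  assumes "finite I" "x \<notin> I"
  shows "(\<Sum>A\<in>Pow (insert x I). g A) = (\<Sum>A\<in>Pow I. g A + g (insert x A))"
proof -
  have "inj_on (insert x) (Pow I)"
    using assms(2) by (auto simp: inj_on_def)
  moreover have "Pow I \<inter> insert x ` Pow I = {}"
    using assms(2) by auto
  ultimately show ?thesis
    using assms(1) by (simp add: Pow_insert sum.union_disjoint sum.reindex sum.distrib)
qed

text \<open>A Rademacher sum, with the sign pattern encoded as the set \<open>A\<close> of indices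
  of sign plus. Averages over signs then become finite sums over \<open>Pow I\<close>.\<close>

definition signed_sum :: "('a \<Rightarrow> real) \<Rightarrow> 'a set \<Rightarrow> 'a set \<Rightarrow> real" where
  "signed_sum b I A = (\<Sum>i\<in>I. (if i \<in> A then b i else - b i))"

lemma signed_sum_insert:
  assumes "finite I" "x \<notin> I" "A \<subseteq> I"
  shows "signed_sum b (insert x I) A = signed_sum b I A - b x"
    and "signed_sum b (insert x I) (insert x A) = signed_sum b I A + b x"
proof -
  have "(\<Sum>i\<in>I. (if i \<in> insert x A then b i else - b i)) = (\<Sum>i\<in>I. (if i \<in> A then b i else - b i))"
    using assms by (intro sum.cong) auto
  then show "signed_sum b (insert x I) A = signed_sum b I A - b x"
    "signed_sum b (insert x I) (insert x A) = signed_sum b I A + b x"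
    using assms by (auto simp: signed_sum_def)
qed

text \<open>Mixed terms cancel between the two signs of a new index:
  \<open>(y - c)^2 + (y + c)^2 = 2 * y^2 + 2 * c^2\<close>.\<close>

lemma sum_signed_sum_power2:
  assumes "finite I"
  shows "(\<Sum>A\<in>Pow I. (signed_sum b I A)^2) = 2 ^ card I * (\<Sum>i\<in>I. (b i)^2)"
  using assms
proof (induction I)
  case empty
  then show ?case by (simp add: signed_sum_def)
next
  case (insert x I)
  have "(\<Sum>A\<in>Pow (insert x I). (signed_sum b (insert x I) A)^2)
      = (\<Sum>A\<in>Pow I. 2 * (signed_sum b I A)^2 + 2 * (b x)^2)"
    unfolding sum_Pow_insert[OF insert.hyps]
    by (intro sum.cong refl)
      (simp add: signed_sum_insert insert.hyps power2_eq_square algebra_simps)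
  also have "\<dots> = 2 ^ card (insert x I) * (\<Sum>i\<in>insert x I. (b i)^2)"
    using insert by (simp add: sum.distrib card_Pow algebra_simps flip: sum_distrib_left)
  finally show ?case .
qed

text \<open>The same pairing of signs produces the mean \<open>y^4 + 6 * c^2 * y^2 + c^4\<close>.
  The constant 3 is what the mixed term calls for, as the cross term of
  \<open>3 * (S + c^2)^2\<close>, where \<open>S\<close> is the sum of squares so far.\<close>

lemma sum_signed_sum_power4:
  assumes "finite I"
  shows "(\<Sum>A\<in>Pow I. (signed_sum b I A)^4) \<le> 3 * 2 ^ card I * (\<Sum>i\<in>I. (b i)^2)^2"
  using assms
proof (induction I)
  case empty
  then show ?case by (simp add: signed_sum_def)
next
  case (insert x I)
  have pow4: "(y - c)^4 + (y + c)^4 = 2 * y^4 + 12 * c^2 * y^2 + 2 * c^4" for y c :: real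
    by algebra
  have "(\<Sum>A\<in>Pow (insert x I). (signed_sum b (insert x I) A)^4)
      = (\<Sum>A\<in>Pow I. 2 * (signed_sum b I A)^4 + 12 * (b x)^2 * (signed_sum b I A)^2 + 2 * (b x)^4)"
    unfolding sum_Pow_insert[OF insert.hyps]
    by (intro sum.cong refl) (simp add: signed_sum_insert insert.hyps pow4)
  also have "\<dots> = 2 * (\<Sum>A\<in>Pow I. (signed_sum b I A)^4)
      + 12 * (b x)^2 * (2 ^ card I * (\<Sum>i\<in>I. (b i)^2)) + 2 ^ card I * (2 * (b x)^4)"
    using insert by (simp add: sum.distrib card_Pow sum_signed_sum_power2 flip: sum_distrib_left)
  \<comment> \<open>The coefficient 2 of \<open>(b x)^4\<close> is enlarged to 6 to complete the
    square.\<close>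
  also have "\<dots> \<le> 2 * (3 * 2 ^ card I * (\<Sum>i\<in>I. (b i)^2)^2)
      + 12 * (b x)^2 * (2 ^ card I * (\<Sum>i\<in>I. (b i)^2)) + 2 ^ card I * (6 * (b x)^4)"
    using insert.IH by (intro add_mono mult_left_mono) auto
  also have "\<dots> = 3 * 2 ^ card (insert x I) * (\<Sum>i\<in>insert x I. (b i)^2)^2"
    using insert by (simp add: power2_sum algebra_simps power2_eq_square power4_eq_xxxx)
  finally show ?case .
qed

text \<open>The second and fourth moments control the first: a polynomial inequality bounds
  \<open>\<bar>x\<bar>\<close> from below by a combination of \<open>x^2\<close> and
  \<open>x^4\<close>, and averaging it over signs leaves an absolute constant.\<close>

lemma khinchine:
  assumes "finite I"
  shows "2 ^ card I * sqrt (\<Sum>i\<in>I. (b i)^2) \<le> 3 * (\<Sum>A\<in>Pow I. \<bar>signed_sum b I A\<bar>)"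
proof (cases "(\<Sum>i\<in>I. (b i)^2) = 0")
  case True
  then show ?thesis by (simp add: sum_nonneg)
next
  case False
  define B where "B = (\<Sum>i\<in>I. (b i)^2)"
  \<comment> \<open>After averaging, \<open>pointwise\<close> bounds
    \<open>2 * a^2 * B - 6 * B^2\<close> by \<open>a^3\<close> times the mean absolute value. This
    choice of \<open>a\<close> minimises the resulting constant, which is 9/4 and so below
    3.\<close>
  define a where "a = 3 * sqrt B"
  define N :: real where "N = 2 ^ card I"
  have B: "B > 0" using False unfolding B_def by (simp add: less_le sum_nonneg)
  have a: "a > 0" using B by (simp add: a_def)
  have a2: "a^2 = 9 * B" using B by (simp add: a_def power_mult_distrib)
  (* y^3 minus its tangent line at 3a/5 is (y - 3a/5)^2 (y + 6a/5). *)
  have pointwise: "2 * a^2 * x^2 - 2 * x^4 \<le> a^3 * \<bar>x\<bar>" for x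
  proof -
    define y where "y = \<bar>x\<bar>"
    have y: "y \<ge> 0" "x^2 = y^2" "x^4 = y^4" by (auto simp: y_def)
    have "a^3 - 2 * y * a^2 + 2 * y^3
        = 2 * (y - 3/5 * a)^2 * (y + 6/5 * a) + 17/125 * a^3 + 4/25 * y * a^2"
      by (simp add: power2_eq_square power3_eq_cube field_simps)
    moreover have "\<dots> \<ge> 0" using a y(1) by auto
    ultimately have "0 \<le> y * (a^3 - 2 * y * a^2 + 2 * y^3)"
      using y(1) by simp
    then show ?thesis
      unfolding y(2,3) y_def[symmetric]
      by (simp add: algebra_simps power2_eq_square power3_eq_cube power4_eq_xxxx)
  qed
  have "a^2 * (2 * N * B) - 6 * N * B^2
     \<le> (\<Sum>A\<in>Pow I. 2 * a^2 * (signed_sum b I A)^2 - 2 * (signed_sum b I A)^4)"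
    using sum_signed_sum_power4[OF assms, of b]
    unfolding sum_subtractf sum_distrib_left[symmetric] sum_signed_sum_power2[OF assms]
      B_def[symmetric] N_def[symmetric] by simp
  also have "\<dots> \<le> (\<Sum>A\<in>Pow I. a^3 * \<bar>signed_sum b I A\<bar>)"
    by (intro sum_mono pointwise)
  also have "\<dots> = a^2 * (a * (\<Sum>A\<in>Pow I. \<bar>signed_sum b I A\<bar>))"
    by (simp add: sum_distrib_left power2_eq_square power3_eq_cube mult.assoc)
  finally have "12 * N * B * B \<le> 9 * B * (a * (\<Sum>A\<in>Pow I. \<bar>signed_sum b I A\<bar>))"
    unfolding a2 by (simp add: power2_eq_square)
  then have "12 * N * B \<le> 9 * (a * (\<Sum>A\<in>Pow I. \<bar>signed_sum b I A\<bar>))"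
    using B by (simp add: mult.assoc mult.left_commute)
  moreover have "12 * N * B = sqrt B * (12 * N * sqrt B)" using B by simp
  ultimately have "sqrt B * (12 * N * sqrt B) \<le> sqrt B * (27 * (\<Sum>A\<in>Pow I. \<bar>signed_sum b I A\<bar>))"
    unfolding a_def by (simp only: mult_ac)
  then have "12 * N * sqrt B \<le> 27 * (\<Sum>A\<in>Pow I. \<bar>signed_sum b I A\<bar>)"
    by (rule mult_left_le_imp_le) (use B in auto)
  moreover have "0 \<le> N * sqrt B" using B by (simp add: N_def)
  ultimately show ?thesis
    unfolding B_def[symmetric] N_def[symmetric] by linarith
qed

subsection \<open>Singular values on finite-dimensional subspaces\<close>

text \<open>Against an orthogonal spanning set, Cauchy-Schwarz bounds each coefficient of a unit
  vector by \<open>inverse (norm b)\<close>. The sphere is thus a closed part of a finite sum of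
  compact segments.\<close>

lemma compact_span_sphere:
  fixes B :: "'a::real_inner set"
  assumes "finite B"
  shows "compact (span B \<inter> sphere 0 1)"
proof -
  obtain C where C: "finite C" "span C = span B" "pairwise orthogonal C"
    using basis_orthogonal[OF assms] by blast
  define K where "K = (\<lambda>F :: 'a set. {\<Sum>b\<in>F. c b *\<^sub>R b | c. \<forall>b\<in>F. c b \<in> {- inverse (norm b)..inverse (norm b)}})"
  have compact_K: "compact (K F)" if "finite F" for F
    using that
  proof (induction F)
    case empty
    then show ?case by (simp add: K_def)
  next
    case (insert x F)
    have seg: "compact ((\<lambda>t. t *\<^sub>R x) ` {- inverse (norm x)..inverse (norm x)})"
      by (intro compact_continuous_image continuous_intros) auto
    have "K (insert x F) = {y + z | y z. y \<in> (\<lambda>t. t *\<^sub>R x) ` {- inverse (norm x)..inverse (norm x)} \<and> z \<in> K F}"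
      (is "?L = ?R")
    proof
      show "?L \<subseteq> ?R"
        using insert.hyps by (fastforce simp: K_def)
    next
      show "?R \<subseteq> ?L"
      proof
        fix v assume "v \<in> ?R"
        then obtain t c where t: "t \<in> {- inverse (norm x)..inverse (norm x)}"
          "\<forall>b\<in>F. c b \<in> {- inverse (norm b)..inverse (norm b)}"
          "v = t *\<^sub>R x + (\<Sum>b\<in>F. c b *\<^sub>R b)" by (auto simp: K_def)
        have "(\<Sum>b\<in>F. (c(x := t)) b *\<^sub>R b) = (\<Sum>b\<in>F. c b *\<^sub>R b)"
          using insert.hyps by (intro sum.cong) auto
        then have "v = (\<Sum>b\<in>insert x F. (c(x := t)) b *\<^sub>R b)"
          using t insert.hyps by simp
        moreover have "\<forall>b\<in>insert x F. (c(x := t)) b \<in> {- inverse (norm b)..inverse (norm b)}"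
          using t by auto
        ultimately show "v \<in> ?L" unfolding K_def by blast
      qed
    qed
    then show ?case using compact_sums[OF seg insert.IH] by simp
  qed
  have closed_unit_sphere: "closed (sphere (0::'a) 1)"
    unfolding sphere_def by (intro closed_Collect_eq continuous_intros)
  have "span B \<inter> sphere 0 1 = K C \<inter> sphere 0 1"
  proof (intro equalityI subsetI)
    fix x assume x: "x \<in> span B \<inter> sphere 0 1"
    then obtain c where c: "x = (\<Sum>b\<in>C. c b *\<^sub>R b)"
      using C span_finite[OF C(1)] by auto
    have "\<bar>c b\<bar> \<le> inverse (norm b)" if "b \<in> C" "b \<noteq> 0" for b
    proof -
      have "x \<bullet> b = (\<Sum>b'\<in>C. if b' = b then c b * (b \<bullet> b) else 0)"
        unfolding c inner_sum_left
        using C(3) that by (intro sum.cong) (auto simp: pairwise_def orthogonal_def)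
      also have "\<dots> = c b * (b \<bullet> b)" using C(1) that by simp
      finally have "\<bar>c b\<bar> * (norm b * norm b) \<le> norm b"
        using Cauchy_Schwarz_ineq2[of x b] x
        by (simp add: abs_mult dot_square_norm power2_eq_square)
      then show ?thesis using that by (simp add: field_simps)
    qed
    \<comment> \<open>If \<open>0\<close> lies in \<open>C\<close>, its coefficient is arbitrary. As
      \<open>inverse 0 = 0\<close>, its interval consists of 0 alone, so the coefficient is
      reset.\<close>
    then have "x = (\<Sum>b\<in>C. (if b = 0 then 0 else c b) *\<^sub>R b)"
      "\<forall>b\<in>C. (if b = 0 then 0 else c b) \<in> {- inverse (norm b)..inverse (norm b)}"
      unfolding c by (auto intro!: sum.cong simp: abs_le_iff) (fastforce dest: abs_le_D1 abs_le_D2)+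
    then have "x \<in> K C" unfolding K_def mem_Collect_eq by (intro exI conjI)
    then show "x \<in> K C \<inter> sphere 0 1" using x by blast
  next
    fix x assume "x \<in> K C \<inter> sphere 0 1"
    then show "x \<in> span B \<inter> sphere 0 1"
      unfolding C(2)[symmetric] K_def by (auto intro!: span_sum span_scale intro: span_base)
  qed
  then show ?thesis using compact_K[OF C(1)] by (metis compact_Int_closed closed_unit_sphere)
qed

text \<open>A first-variation principle: near 0 a quadratic term cannot dominate a nonzero linear
  one. It turns maximality into orthogonality.\<close>

lemma eq_0_if_linear_le_quadratic:
  fixes a K :: real
  assumes "\<And>t. 2 * t * a \<le> K * t^2"
  shows "a = 0"
proof (rule ccontr)
  assume "a \<noteq> 0"
  \<comment> \<open>Testing at \<open>t = a / c\<close> gives a contradiction as soon as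
    \<open>c > 0\<close> and \<open>2 * c > K\<close>.\<close>
  define c where "c = \<bar>K\<bar> + 1"
  have c: "c > 0" by (simp add: c_def)
  have "2 * (a / c) * a \<le> K * (a / c)^2" by (rule assms)
  then have "2 * a^2 * c \<le> K * a^2" using c by (simp add: field_simps power2_eq_square)
  then have "a^2 * (2 * c - K) \<le> 0" by (simp add: algebra_simps)
  moreover have "2 * c - K > 0" by (simp add: c_def)
  ultimately show False using \<open>a \<noteq> 0\<close> by (simp add: mult_le_0_iff)
qed

lemma power2_norm_add_scaleR:
  fixes a b :: "'a::real_inner"
  shows "(norm (a + t *\<^sub>R b))\<^sup>2 = (norm a)\<^sup>2 + 2 * t * (a \<bullet> b) + t\<^sup>2 * (norm b)\<^sup>2"
  unfolding power2_norm_eq_inner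
  by (simp add: inner_add_left inner_add_right inner_commute[of b a] power2_eq_square algebra_simps)

lemma independent_orthonormal:
  fixes e :: "nat \<Rightarrow> 'a::real_inner"
  assumes "\<And>i j. i < m \<Longrightarrow> j < m \<Longrightarrow> e i \<bullet> e j = (if i = j then 1 else 0)"
  shows "inj_on e {..<m}" "independent (e ` {..<m})"
proof -
  show "inj_on e {..<m}"
    using assms by (metis inj_onI lessThan_iff zero_neq_one)
  have "pairwise orthogonal (e ` {..<m})" "0 \<notin> e ` {..<m}"
    using assms by (fastforce simp: pairwise_def orthogonal_def,
      metis imageE inner_zero_left lessThan_iff zero_neq_one)
  then show "independent (e ` {..<m})" by (rule pairwise_orthogonal_independent)
qed

text \<open>The family is built greedily: the next vector maximises \<open>norm (u x)\<close> on the unit vectors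
  orthogonal to the previous ones. Stationarity at the maximum gives orthogonality of the images.\<close>

lemma singular_value_decomposition:
  fixes u :: "'a::real_inner \<Rightarrow>\<^sub>L 'b::real_inner"
  assumes "finite B"
  obtains m :: nat and e where
    "\<And>i j. i < m \<Longrightarrow> j < m \<Longrightarrow> e i \<bullet> e j = (if i = j then 1 else 0)"
    "\<And>i j. i < m \<Longrightarrow> j < m \<Longrightarrow> i \<noteq> j \<Longrightarrow> u (e i) \<bullet> u (e j) = 0"
    "\<And>i j. i \<le> j \<Longrightarrow> j < m \<Longrightarrow> norm (u (e j)) \<le> norm (u (e i))"
    "\<And>x. x \<in> span B \<Longrightarrow> x = (\<Sum>i<m. (x \<bullet> e i) *\<^sub>R e i)"
proof -
  define perp where "perp = (\<lambda>(m::nat) e. {x \<in> span B. \<forall>i<m. x \<bullet> e i = (0::real)})"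
  \<comment> \<open>The last clause is the invariant that keeps the construction going: a vector
    still available has its image orthogonal to each \<open>u (e i)\<close> and is stretched by at
    most \<open>norm (u (e i))\<close>.\<close>
  define good where "good = (\<lambda>(m::nat) e. (\<forall>i<m. e i \<in> span B)
     \<and> (\<forall>i<m. \<forall>j<m. e i \<bullet> e j = (if i = j then 1 else 0))
     \<and> (\<forall>i<m. \<forall>j<m. i \<noteq> j \<longrightarrow> u (e i) \<bullet> u (e j) = 0)
     \<and> (\<forall>j<m. \<forall>i\<le>j. norm (u (e j)) \<le> norm (u (e i)))
     \<and> (\<forall>i<m. \<forall>x\<in>perp m e. u (e i) \<bullet> u x = 0 \<and> norm (u x) \<le> norm (u (e i)) * norm x))"
  have bound: "m \<le> card B" if "good m e" for m e
  proof -
    have orth: "e i \<bullet> e j = (if i = j then 1 else 0)" if "i < m" "j < m" for i j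
      using \<open>good m e\<close> that by (auto simp: good_def)
    have "e ` {..<m} \<subseteq> span B" using that by (auto simp: good_def)
    then have "card (e ` {..<m}) \<le> card B"
      using independent_span_bound[OF assms] independent_orthonormal[of m e] orth by blast
    then show ?thesis using independent_orthonormal(1)[of m e] orth
      by (simp add: card_image)
  qed
  have "good 0 (\<lambda>_. 0)" by (simp add: good_def)
  \<comment> \<open>Orthonormal families in \<open>span B\<close> have at most \<open>card B\<close>
    members, so a good family of greatest length exists.\<close>
  then obtain m where m: "\<exists>e. good m e" and max: "\<And>k. \<exists>e. good k e \<Longrightarrow> k \<le> m"
    using ex_has_greatest_nat[of "\<lambda>m. \<exists>e. good m e" 0 id "Suc (card B)"] bound
    by (auto simp: less_Suc_eq_le)
  from m obtain e where e: "good m e" by blast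
  have eB: "e i \<in> span B" if "i < m" for i using e that by (auto simp: good_def)
  have orth: "e i \<bullet> e j = (if i = j then 1 else 0)" if "i < m" "j < m" for i j
    using e that by (auto simp: good_def)
  have perp_add: "x + y \<in> perp m e" if "x \<in> perp m e" "y \<in> perp m e" for x y
    using that by (auto simp: perp_def inner_add_left intro: span_add)
  have perp_scale: "c *\<^sub>R x \<in> perp m e" if "x \<in> perp m e" for x c
    using that by (auto simp: perp_def intro: span_scale)
  \<comment> \<open>A nonzero vector of \<open>perp m e\<close> would permit one more greedy step,
    against the maximality of \<open>m\<close>.\<close>
  have perp0: "x = 0" if x: "x \<in> perp m e" for x
  proof (rule ccontr)
    assume "x \<noteq> 0"
    define W where "W = perp m e \<inter> sphere 0 1"
    have "W = (span B \<inter> sphere 0 1) \<inter> (\<Inter>i\<in>{..<m}. {x. x \<bullet> e i = 0})"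
      by (auto simp: W_def perp_def)
    moreover have "closed {x. x \<bullet> e i = 0}" for i
      by (intro closed_Collect_eq continuous_intros)
    ultimately have "compact W"
      using compact_span_sphere[OF assms] by (metis (no_types, lifting) closed_INT compact_Int_closed)
    moreover have "W \<noteq> {}"
      using perp_scale[OF x, of "inverse (norm x)"] \<open>x \<noteq> 0\<close> by (auto simp: W_def)
    moreover have "continuous_on W (\<lambda>x. norm (u x))" by (intro continuous_intros)
    ultimately have "\<exists>v\<in>W. \<forall>y\<in>W. norm (u y) \<le> norm (u v)"
      by (rule continuous_attains_sup)
    then obtain v where v: "v \<in> W" and vmax: "\<And>y. y \<in> W \<Longrightarrow> norm (u y) \<le> norm (u v)"
      by auto
    have vp: "v \<in> perp m e" "norm v = 1" using v by (auto simp: W_def)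
    have vle: "norm (u y) \<le> norm (u v) * norm y" if "y \<in> perp m e" for y
    proof (cases "y = 0")
      case False
      then have "inverse (norm y) *\<^sub>R y \<in> W" using perp_scale[OF that] by (auto simp: W_def)
      from vmax[OF this] False show ?thesis by (simp add: blinfun.scaleR_right field_simps)
    qed simp
    \<comment> \<open>Moving from \<open>v\<close> in a direction \<open>y\<close> orthogonal to it
      changes the norm only to second order, so maximality of \<open>v\<close> leaves no first-order
      term in the norm of the image.\<close>
    have vorth: "u v \<bullet> u y = 0" if y: "y \<in> perp m e" "y \<bullet> v = 0" for y
    proof (rule eq_0_if_linear_le_quadratic)
      fix t
      have "norm (u (v + t *\<^sub>R y)) \<le> norm (u v) * norm (v + t *\<^sub>R y)"
        by (intro vle perp_add perp_scale vp y)
      then have "(norm (u v + t *\<^sub>R u y))^2 \<le> (norm (u v))^2 * (norm (v + t *\<^sub>R y))^2"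
        by (simp add: blinfun.add_right blinfun.scaleR_right flip: power_mult_distrib)
      moreover have "(norm (u v + t *\<^sub>R u y))^2 = (norm (u v))^2 + 2 * t * (u v \<bullet> u y) + t^2 * (norm (u y))^2"
        by (rule power2_norm_add_scaleR)
      moreover have "(norm (v + t *\<^sub>R y))^2 = 1 + t^2 * (norm y)^2"
        using vp(2) y(2) by (simp add: power2_norm_add_scaleR inner_commute)
      ultimately have "2 * t * (u v \<bullet> u y) \<le> (norm (u v))^2 * (t^2 * (norm y)^2) - t^2 * (norm (u y))^2"
        by (simp add: algebra_simps)
      then show "2 * t * (u v \<bullet> u y) \<le> ((norm (u v))^2 * (norm y)^2 - (norm (u y))^2) * t^2"
        by (simp add: algebra_simps)
    qed
    define e' where "e' = e(m := v)"
    have e'1: "e' m = v" "\<And>i. i < m \<Longrightarrow> e' i = e i" by (auto simp: e'_def)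
    have perp': "perp (Suc m) e' = {y \<in> perp m e. y \<bullet> v = 0}"
      by (auto simp: perp_def e'_def less_Suc_eq)
    have old: "u (e i) \<bullet> u y = 0" "norm (u y) \<le> norm (u (e i)) * norm y"
      if "i < m" "y \<in> perp m e" for i y
      using e that by (auto simp: good_def)
    have vei: "v \<bullet> e i = 0" "e i \<bullet> v = 0" if "i < m" for i
      using vp(1) that by (auto simp: perp_def inner_commute)
    have "good (Suc m) e'"
      unfolding good_def
    proof (intro conjI allI impI ballI)
      show "e' i \<in> span B" if "i < Suc m" for i
        using that eB vp(1) by (auto simp: less_Suc_eq e'1 perp_def)
      show "e' i \<bullet> e' j = (if i = j then 1 else 0)" if "i < Suc m" "j < Suc m" for i j
        using that orth vei vp(2) by (auto simp: less_Suc_eq e'1 norm_eq_1)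
      show "u (e' i) \<bullet> u (e' j) = 0" if "i < Suc m" "j < Suc m" "i \<noteq> j" for i j
        using that old(1)[OF _ vp(1)] e
        by (auto simp: less_Suc_eq e'1 good_def inner_commute)
      show "norm (u (e' j)) \<le> norm (u (e' i))" if "j < Suc m" "i \<le> j" for i j
        using that old(2)[OF _ vp(1)] e vp(2)
        by (cases "i = j") (auto simp: less_Suc_eq e'1 good_def)
      show "u (e' i) \<bullet> u y = 0" if "i < Suc m" "y \<in> perp (Suc m) e'" for i y
        using that old(1) vorth by (auto simp: less_Suc_eq e'1 perp')
      show "norm (u y) \<le> norm (u (e' i)) * norm y" if "i < Suc m" "y \<in> perp (Suc m) e'" for i y
        using that old(2) vle by (auto simp: less_Suc_eq e'1 perp')
    qed
    then show False using max[of "Suc m"] by auto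
  qed
  show thesis
  proof (rule that[of m e])
    fix x assume x: "x \<in> span B"
    have "(\<Sum>j<m. (x \<bullet> e j) *\<^sub>R e j) \<bullet> e i = x \<bullet> e i" if "i < m" for i
    proof -
      have "(\<Sum>j<m. (x \<bullet> e j) *\<^sub>R e j) \<bullet> e i = (\<Sum>j<m. if j = i then x \<bullet> e i else 0)"
        unfolding inner_sum_left using that by (intro sum.cong) (auto simp: orth)
      then show ?thesis using that by simp
    qed
    then have "x - (\<Sum>i<m. (x \<bullet> e i) *\<^sub>R e i) \<in> perp m e"
      using x eB
      by (auto simp: perp_def inner_diff_left intro!: span_diff span_sum span_scale)
    from perp0[OF this] show "x = (\<Sum>i<m. (x \<bullet> e i) *\<^sub>R e i)" by simp
  qed (use e in \<open>auto simp: good_def\<close>)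
qed

text \<open>An operator of rank at most \<open>n\<close> annihilates a nonzero combination of the
  \<open>n + 1\<close> vectors \<open>e 0\<close> to \<open>e n\<close>. On their span
  \<open>u\<close> stretches by at least \<open>norm (u (e n))\<close>, since the images are
  orthogonal with decreasing norms. The family starts at index 0, the approximation numbers at 1,
  whence \<open>Suc n\<close>.\<close>

lemma approx_number_ge:
  fixes u :: "'a::real_inner \<Rightarrow>\<^sub>L 'b::real_inner"
  assumes orth: "\<And>i j. i < m \<Longrightarrow> j < m \<Longrightarrow> e i \<bullet> e j = (if i = j then 1 else 0)"
    and uorth: "\<And>i j. i < m \<Longrightarrow> j < m \<Longrightarrow> i \<noteq> j \<Longrightarrow> u (e i) \<bullet> u (e j) = 0"
    and decr: "\<And>i j. i \<le> j \<Longrightarrow> j < m \<Longrightarrow> norm (u (e j)) \<le> norm (u (e i))"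
    and n: "n < m"
  shows "norm (u (e n)) \<le> approx_number u (Suc n)"
  unfolding approx_number_def
proof (rule cInf_greatest)
  have "rank_less (0 :: 'a \<Rightarrow>\<^sub>L 'b) (Suc n)"
    unfolding rank_less_def using dim_eq_card[OF _ independent_empty, of "{0::'b}"] by (auto simp del: dim_eq_0 intro!: exI[of _ "{}"])
  then show "{norm (u - v) |v. rank_less v (Suc n)} \<noteq> {}" by blast
next
  fix r assume "r \<in> {norm (u - v) |v. rank_less v (Suc n)}"
  then obtain v B where r: "r = norm (u - v)" and B: "finite B" "range (blinfun_apply v) \<subseteq> span B"
    and dim: "dim (range (blinfun_apply v)) < Suc n" by (auto simp: rank_less_def)
  obtain C where C: "C \<subseteq> range (blinfun_apply v)" "independent C" "range (blinfun_apply v) \<subseteq> span C"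
    "card C = dim (range (blinfun_apply v))"
    using basis_exists by blast
  have fC: "finite C" using independent_span_bound[OF B(1) C(2)] C(1) B(2) by blast
  \<comment> \<open>Linear dependence is a statement about sets, so a coincidence
    \<open>v (e i) = v (e j)\<close> is treated apart: there \<open>e i - e j\<close> is
    annihilated.\<close>
  have "\<exists>c. (\<exists>i\<le>n. c i \<noteq> 0) \<and> (\<Sum>i\<le>n. c i *\<^sub>R v (e i)) = 0"
  proof (cases "inj_on (\<lambda>i. v (e i)) {..n}")
    case True
    have "\<not> independent ((\<lambda>i. v (e i)) ` {..n})"
    proof
      assume "independent ((\<lambda>i. v (e i)) ` {..n})"
      moreover have "(\<lambda>i. v (e i)) ` {..n} \<subseteq> span C" using C(3) by auto
      ultimately have "card ((\<lambda>i. v (e i)) ` {..n}) \<le> card C"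
        using independent_span_bound[OF fC] by blast
      then show False using True C(4) dim by (simp add: card_image)
    qed
    then obtain c where c: "(\<Sum>y\<in>(\<lambda>i. v (e i)) ` {..n}. c y *\<^sub>R y) = 0"
      "\<exists>y\<in>(\<lambda>i. v (e i)) ` {..n}. c y \<noteq> 0"
      by (auto simp: dependent_finite)
    then show ?thesis
      using True by (intro exI[of _ "\<lambda>i. c (v (e i))"]) (auto simp: sum.reindex)
  next
    case False
    then obtain i j where ij: "i \<le> n" "j \<le> n" "i \<noteq> j" "v (e i) = v (e j)"
      by (auto simp: inj_on_def)
    define c :: "nat \<Rightarrow> real" where "c = (\<lambda>k. (if k = i then 1 else 0) - (if k = j then 1 else 0))"
    have "(\<Sum>k\<le>n. c k *\<^sub>R v (e k)) = 0"
      using ij by (simp add: c_def scaleR_diff_left sum_subtractf if_distrib[of "\<lambda>c. c *\<^sub>R _"] cong: if_cong)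
    moreover have "c i \<noteq> 0" using ij by (simp add: c_def)
    ultimately show ?thesis using ij(1) by blast
  qed
  then obtain c where c: "\<exists>i\<le>n. c i \<noteq> 0" "(\<Sum>i\<le>n. c i *\<^sub>R v (e i)) = 0" by blast
  define x where "x = (\<Sum>i\<le>n. c i *\<^sub>R e i)"
  have vx: "v x = 0" using c(2) by (simp add: x_def blinfun.sum_right blinfun.scaleR_right)
  have nx: "(norm x)^2 = (\<Sum>i\<le>n. (c i)^2)"
    unfolding x_def power2_norm_eq_inner inner_sum_left inner_sum_right
    using n by (simp add: orth if_distrib power2_eq_square cong: if_cong)
  have "(norm (u x))^2 = (\<Sum>i\<le>n. \<Sum>j\<le>n. c i * (c j * (u (e i) \<bullet> u (e j))))"
    unfolding x_def power2_norm_eq_inner by (simp add: blinfun.sum_right blinfun.scaleR_right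
      inner_sum_left inner_sum_right sum_distrib_left inner_commute mult.left_commute)
  also have "\<dots> = (\<Sum>i\<le>n. \<Sum>j\<le>n. if j = i then (c i)^2 * (norm (u (e i)))^2 else 0)"
    using n by (intro sum.cong refl)
      (auto simp: uorth dot_square_norm power2_eq_square)
  also have "\<dots> = (\<Sum>i\<le>n. (c i)^2 * (norm (u (e i)))^2)" by simp
  also have "\<dots> \<ge> (\<Sum>i\<le>n. (c i)^2 * (norm (u (e n)))^2)"
    using n by (intro sum_mono mult_left_mono power_mono decr) auto
  finally have "(norm (u (e n)))^2 * (norm x)^2 \<le> (norm (u x))^2"
    unfolding nx sum_distrib_left by (simp add: mult.commute)
  then have "(norm (u (e n)) * norm x)^2 \<le> (norm (u x))^2"
    by (simp add: power_mult_distrib)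
  then have "norm (u (e n)) * norm x \<le> norm (u x)"
    by (rule power2_le_imp_le) simp
  also have "\<dots> = norm ((u - v) x)" by (simp add: vx blinfun.diff_left)
  also have "\<dots> \<le> norm (u - v) * norm x" by (rule norm_blinfun)
  finally have "norm (u (e n)) * norm x \<le> r * norm x" by (simp add: r)
  moreover have "(norm x)^2 > 0"
  proof -
    obtain i where "i \<le> n" "c i \<noteq> 0" using c(1) by blast
    then show ?thesis unfolding nx by (intro sum_pos2[of _ i]) auto
  qed
  ultimately show "norm (u (e n)) \<le> r"
    by simp
qed

subsection \<open>Pointwise domination\<close>

text \<open>At positive points this is \<open>powr_convex\<close>; if a point is 0, it reduces to
  \<open>t powr p \<le> t\<close> for \<open>t\<close> between 0 and 1.\<close>

lemma convex_on_powr_nonneg: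
  assumes "p \<ge> 1"
  shows "convex_on {0..} (\<lambda>x::real. x powr p)"
proof (rule convex_onI)
  have scale: "(t * y) powr p \<le> t * y powr p" if "0 < t" "t < 1" "0 \<le> y" for t y :: real
  proof -
    have "t powr p \<le> t powr 1" using that assms by (intro powr_mono') auto
    then show ?thesis using that by (simp add: powr_mult mult_right_mono)
  qed
  fix t x y :: real assume t: "0 < t" "t < 1" and xy: "x \<in> {0..}" "y \<in> {0..}"
  show "((1 - t) *\<^sub>R x + t *\<^sub>R y) powr p \<le> (1 - t) * x powr p + t * y powr p"
  proof (cases "x = 0 \<or> y = 0")
    case True
    then show ?thesis using scale[of t y] scale[of "1 - t" x] t xy by auto
  next
    case False
    then show ?thesis
      using convex_onD[OF powr_convex[OF assms], of t x y] t xy by auto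
  qed
qed simp

text \<open>With weights \<open>(x \<bullet> e i)\<^sup>2 / (norm x)\<^sup>2\<close>, this is Jensen's inequality for \<open>t powr p\<close>; it replaces
  the \<open>p\<close>-th power of \<open>norm (u x)\<close> by the Hilbert-Schmidt operator \<open>\<bar>u\<bar>\<^sup>p\<close>.\<close>

lemma powr_norm_le_hilbert_schmidt:
  fixes u :: "'a::real_inner \<Rightarrow>\<^sub>L 'b::real_inner" and m :: nat
  assumes p: "1 \<le> p"
    and orth: "\<And>i j. i < m \<Longrightarrow> j < m \<Longrightarrow> e i \<bullet> e j = (if i = j then 1 else 0)"
    and uorth: "\<And>i j. i < m \<Longrightarrow> j < m \<Longrightarrow> i \<noteq> j \<Longrightarrow> u (e i) \<bullet> u (e j) = 0"
    and x: "x = (\<Sum>i<m. (x \<bullet> e i) *\<^sub>R e i)"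
  shows "norm (u x) powr p
    \<le> norm x powr (p - 1) * sqrt (\<Sum>i<m. (norm (u (e i)) powr p * (x \<bullet> e i))\<^sup>2)"
proof (cases "x = 0")
  case False
  define w where "w i = (x \<bullet> e i)\<^sup>2 / (norm x)\<^sup>2" for i
  have nx: "norm x > 0" using False by simp
  have "(norm x)\<^sup>2 = x \<bullet> (\<Sum>i<m. (x \<bullet> e i) *\<^sub>R e i)"
    using x by (simp add: power2_norm_eq_inner)
  then have "(\<Sum>i<m. (x \<bullet> e i)\<^sup>2) = (norm x)\<^sup>2"
    by (simp add: inner_sum_right power2_eq_square)
  \<comment> \<open>By Parseval in the span of the family, the \<open>w i\<close> are admissible
    weights for Jensen's inequality.\<close>
  then have w1: "(\<Sum>i<m. w i) = 1"
    using nx unfolding w_def by (simp flip: sum_divide_distrib)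
  have ux: "u x = (\<Sum>i<m. (x \<bullet> e i) *\<^sub>R u (e i))"
    by (subst x) (simp add: blinfun.sum_right blinfun.scaleR_right)
  have "(norm (u x))\<^sup>2 = (\<Sum>i<m. \<Sum>j<m. (x \<bullet> e i) * ((x \<bullet> e j) * (u (e i) \<bullet> u (e j))))"
    unfolding ux power2_norm_eq_inner
    by (simp add: inner_sum_left inner_sum_right sum_distrib_left inner_commute mult.left_commute)
  also have "\<dots> = (\<Sum>i<m. \<Sum>j<m. if j = i then (x \<bullet> e i)\<^sup>2 * (norm (u (e i)))\<^sup>2 else 0)"
    by (intro sum.cong refl) (auto simp: uorth dot_square_norm power2_eq_square)
  also have "\<dots> = (\<Sum>i<m. (x \<bullet> e i)\<^sup>2 * (norm (u (e i)))\<^sup>2)"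
    by (intro sum.cong refl) simp
  also have "\<dots> = (norm x)\<^sup>2 * (\<Sum>i<m. w i * (norm (u (e i)))\<^sup>2)"
    using nx by (simp add: w_def sum_distrib_left)
  finally have ux2: "(norm (u x))\<^sup>2 = (norm x)\<^sup>2 * (\<Sum>i<m. w i * (norm (u (e i)))\<^sup>2)" .
  have "{..<m} \<noteq> {}" using w1 by auto
  then have "(\<Sum>i<m. w i *\<^sub>R (norm (u (e i)))\<^sup>2) powr p \<le> (\<Sum>i<m. w i * ((norm (u (e i)))\<^sup>2) powr p)"
    using w1 by (intro convex_on_sum[OF _ _ convex_on_powr_nonneg[OF p]]) (auto simp: w_def)
  also have "\<dots> = (\<Sum>i<m. (norm (u (e i)) powr p * (x \<bullet> e i))\<^sup>2) / (norm x)\<^sup>2"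
    by (simp add: w_def sum_divide_distrib power2_eq_square powr_mult mult_ac)
  finally have "((norm x)\<^sup>2) powr p * (\<Sum>i<m. w i * (norm (u (e i)))\<^sup>2) powr p
      \<le> ((norm x)\<^sup>2) powr p * ((\<Sum>i<m. (norm (u (e i)) powr p * (x \<bullet> e i))\<^sup>2) / (norm x)\<^sup>2)"
    by (intro mult_left_mono) simp_all
  moreover have "((norm x)\<^sup>2) powr p * (\<Sum>i<m. w i * (norm (u (e i)))\<^sup>2) powr p = (norm (u x) powr p)\<^sup>2"
  proof -
    have "(norm (u x) powr p)\<^sup>2 = ((norm (u x))\<^sup>2) powr p"
      by (simp add: power2_eq_square powr_mult)
    then show ?thesis unfolding ux2
      by (simp add: powr_mult w_def sum_nonneg)
  qed
  \<comment> \<open>One factor \<open>(norm x)\<^sup>2\<close> cancels the denominator of the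
    weights; the other becomes \<open>norm x powr (p - 1)\<close> under the square root.\<close>
  moreover have "((norm x)\<^sup>2) powr p = (norm x)\<^sup>2 * (norm x powr (p - 1))\<^sup>2"
    using nx by (simp add: power2_eq_square powr_mult powr_diff)
  ultimately have "(norm (u x) powr p)\<^sup>2
      \<le> (norm x powr (p - 1))\<^sup>2 * (\<Sum>i<m. (norm (u (e i)) powr p * (x \<bullet> e i))\<^sup>2)"
    using nx by simp
  then have "norm (u x) powr p
      \<le> sqrt ((norm x powr (p - 1))\<^sup>2 * (\<Sum>i<m. (norm (u (e i)) powr p * (x \<bullet> e i))\<^sup>2))"
    by (rule real_le_rsqrt)
  then show ?thesis by (simp add: real_sqrt_mult)
qed simp

text \<open>Averaging over signs replaces the Hilbert-Schmidt norm by functionals, whose integrals the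
  norm \<open>Phi\<close> controls.\<close>

lemma powr_norm_le_average_functionals:
  fixes u :: "'h::real_inner \<Rightarrow>\<^sub>L 'h"
  assumes p: "1 \<le> p" and u: "approximable (2 * p) u" and B: "finite B"
    and R: "R = sqrt (\<Sum>n. approx_number u (Suc n) powr (2 * p)) + 1"
  obtains I :: "nat set set" and y :: "nat set \<Rightarrow> 'h" where
    "finite I" "I \<noteq> {}" "\<And>A. A \<in> I \<Longrightarrow> norm (y A) \<le> 1"
    "\<And>x. x \<in> span B \<Longrightarrow> real (card I) * norm (u x) powr p
       \<le> 3 * R * (\<Sum>A\<in>I. \<bar>x \<bullet> y A\<bar> * norm x powr (p - 1))"
proof -
  obtain m :: nat and e :: "nat \<Rightarrow> 'h" where
    orth: "\<And>i j. i < m \<Longrightarrow> j < m \<Longrightarrow> e i \<bullet> e j = (if i = j then 1 else 0)" and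
    uorth: "\<And>i j. i < m \<Longrightarrow> j < m \<Longrightarrow> i \<noteq> j \<Longrightarrow> u (e i) \<bullet> u (e j) = 0" and
    decr: "\<And>i j. i \<le> j \<Longrightarrow> j < m \<Longrightarrow> norm (u (e j)) \<le> norm (u (e i))" and
    expand: "\<And>x. x \<in> span B \<Longrightarrow> x = (\<Sum>i<m. (x \<bullet> e i) *\<^sub>R e i)"
    by (rule singular_value_decomposition[OF B, of u]) (rule that)
  define s where "s i = norm (u (e i)) powr p" for i
  define S where "S = (\<Sum>n. approx_number u (Suc n) powr (2 * p))"
  have R': "R = sqrt S + 1" by (simp add: R S_def)
  \<comment> \<open>This is where \<open>2 * p\<close>-approximability enters. The bound
    \<open>S\<close> depends on \<open>u\<close> and \<open>p\<close> but not on \<open>B\<close>,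
    so the constant is uniform over finite-dimensional subspaces.\<close>
  have sum_s: "(\<Sum>i<m. (s i)\<^sup>2) \<le> S"
  proof -
    have "(\<Sum>i<m. (s i)\<^sup>2) = (\<Sum>i<m. norm (u (e i)) powr (2 * p))"
      unfolding s_def by (intro sum.cong) (simp_all add: power2_eq_square flip: powr_add)
    also have "\<dots> \<le> (\<Sum>i<m. approx_number u (Suc i) powr (2 * p))"
      using p approx_number_ge[OF orth uorth decr] by (intro sum_mono powr_mono2) auto
    also have "\<dots> \<le> S"
      unfolding S_def using u by (intro sum_le_suminf) (auto simp: approximable_def)
    finally show ?thesis .
  qed
  then have S: "S \<ge> 0" by (meson order_trans sum_nonneg zero_le_power2)
  \<comment> \<open>The summand 1 keeps \<open>R\<close> positive even for \<open>u = 0\<close>, so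
    that division by \<open>R\<close> is legitimate.\<close>
  then have Rpos: "R > 0" unfolding R' by (simp add: add_nonneg_pos)
  define g where "g A i = (if i \<in> A then s i else - s i)" for A i
  \<comment> \<open>The norm of \<open>z A\<close> does not depend on the signs, and pairing
    \<open>x\<close> with \<open>z A\<close> gives a Rademacher sum. Rescaling by \<open>R\<close>
    puts \<open>y A\<close> into the unit ball.\<close>
  define z where "z A = (\<Sum>i<m. g A i *\<^sub>R e i)" for A
  define y where "y A = z A /\<^sub>R R" for A
  have ny: "norm (y A) \<le> 1" for A
  proof -
    have "(norm (z A))\<^sup>2 = (\<Sum>i<m. \<Sum>j<m. if j = i then (s i)\<^sup>2 else 0)"
      unfolding z_def power2_norm_eq_inner inner_sum_left inner_sum_right
      by (intro sum.cong refl) (auto simp: orth g_def power2_eq_square)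
    also have "\<dots> = (\<Sum>i<m. (s i)\<^sup>2)"
      by (intro sum.cong refl) simp
    also have "\<dots> \<le> S" by (rule sum_s)
    finally have "norm (z A) \<le> sqrt S" by (rule real_le_rsqrt)
    then show ?thesis using Rpos unfolding y_def R' by (simp add: field_simps)
  qed
  have inner_z: "x \<bullet> z A = signed_sum (\<lambda>i. s i * (x \<bullet> e i)) {..<m} A" for x A
    unfolding z_def signed_sum_def g_def inner_sum_right by (intro sum.cong) auto
  have main: "real (card (Pow {..<m})) * norm (u x) powr p
       \<le> 3 * R * (\<Sum>A\<in>Pow {..<m}. \<bar>x \<bullet> y A\<bar> * norm x powr (p - 1))" if "x \<in> span B" for x
  proof -
    have "real (card (Pow {..<m})) * norm (u x) powr p
      \<le> 2 ^ m * (norm x powr (p - 1) * sqrt (\<Sum>i<m. (s i * (x \<bullet> e i))\<^sup>2))"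
      using powr_norm_le_hilbert_schmidt[OF p orth uorth expand[OF that]]
      by (simp add: card_Pow s_def)
    also have "\<dots> = norm x powr (p - 1) * (2 ^ m * sqrt (\<Sum>i<m. (s i * (x \<bullet> e i))\<^sup>2))"
      by simp
    also have "\<dots> \<le> norm x powr (p - 1) * (3 * (\<Sum>A\<in>Pow {..<m}. \<bar>x \<bullet> z A\<bar>))"
      unfolding inner_z
      using khinchine[of "{..<m}" "\<lambda>i. s i * (x \<bullet> e i)"] by (intro mult_left_mono) auto
    also have "\<dots> = 3 * R * (\<Sum>A\<in>Pow {..<m}. \<bar>x \<bullet> y A\<bar> * norm x powr (p - 1))"
    proof -
      have "\<bar>x \<bullet> z A\<bar> = R * \<bar>x \<bullet> y A\<bar>" for A
        using Rpos by (simp add: y_def abs_mult)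
      then show ?thesis by (simp add: sum_distrib_left mult_ac)
    qed
    finally show ?thesis .
  qed
  show thesis
    by (rule that[of "Pow {..<m}" y]) (use ny main in auto)
qed

subsection \<open>Integration of vector-valued simple functions\<close>

lemma (in finite_measure) integrable_simple_function_real:
  fixes f :: "'a \<Rightarrow> real"
  assumes "simple_function M f"
  shows "integrable M f"
proof -
  have "bounded (f ` space M)"
    using simple_functionD(1)[OF assms] by (rule finite_imp_bounded)
  then obtain B where "\<And>w. w \<in> space M \<Longrightarrow> norm (f w) \<le> B"
    by (auto simp: bounded_iff)
  then show ?thesis
    using borel_measurable_simple_function[OF assms]
    by (intro integrable_const_bound[where B = B]) auto
qed

text \<open>\<open>g\<close> can be arbitrary: \<open>f\<close> takes finitely many values, so its
  composition with \<open>g\<close> is again simple.\<close>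

lemma (in finite_measure) integrable_simple_compose:
  assumes "simple_function M f"
  shows "integrable M (\<lambda>w. g (f w) :: real)"
  by (intro integrable_simple_function_real simple_function_compose1[OF assms])

text \<open>Scalar measurability comes from pointwise limits of simple functions, so a nonseparable
  range causes no difficulty.\<close>

lemma strongly_measurable_compose:
  fixes f :: "'w \<Rightarrow> 'a::real_normed_vector" and g :: "'a \<Rightarrow> real"
  assumes "strongly_measurable M f" "continuous_on UNIV g"
  shows "(\<lambda>w. g (f w)) \<in> borel_measurable M"
proof -
  from assms(1) obtain s where s: "\<And>n. simple_function M (s n)"
    "\<And>w. w \<in> space M \<Longrightarrow> (\<lambda>n. s n w) \<longlonglongrightarrow> f w"
    unfolding strongly_measurable_def by blast
  show ?thesis
  proof (rule borel_measurable_LIMSEQ_real)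
    show "(\<lambda>n. g (s n w)) \<longlonglongrightarrow> g (f w)" if "w \<in> space M" for w
      using s(2)[OF that] assms(2) continuous_on_tendsto_compose[of UNIV g "\<lambda>n. s n w" "f w" sequentially] by simp
    show "(\<lambda>w. g (s n w)) \<in> borel_measurable M" for n
      by (intro borel_measurable_simple_function simple_function_compose1[OF s(1)])
  qed
qed

lemma strongly_measurable_blinfun:
  fixes u :: "'a::real_normed_vector \<Rightarrow>\<^sub>L 'b::real_normed_vector"
  assumes "strongly_measurable M f"
  shows "strongly_measurable M (\<lambda>w. u (f w))"
proof -
  from assms obtain s where s: "\<And>n. simple_function M (s n)"
    "\<And>w. w \<in> space M \<Longrightarrow> (\<lambda>n. s n w) \<longlonglongrightarrow> f w"
    unfolding strongly_measurable_def by blast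
  show ?thesis
    unfolding strongly_measurable_def
    by (rule exI[of _ "\<lambda>n w. u (s n w)"])
      (auto intro!: simple_function_compose1[OF s(1)] s(2) blinfun.tendsto)
qed

lemma strongly_measurable_diff:
  fixes f g :: "'w \<Rightarrow> 'a::real_normed_vector"
  assumes "strongly_measurable M f" "strongly_measurable M g"
  shows "strongly_measurable M (\<lambda>w. f w - g w)"
proof -
  from assms obtain s t where s: "\<And>n. simple_function M (s n)"
    "\<And>w. w \<in> space M \<Longrightarrow> (\<lambda>n. s n w) \<longlonglongrightarrow> f w"
    and t: "\<And>n. simple_function M (t n)"
    "\<And>w. w \<in> space M \<Longrightarrow> (\<lambda>n. t n w) \<longlonglongrightarrow> g w"
    unfolding strongly_measurable_def by blast
  show ?thesis
    unfolding strongly_measurable_def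
    by (rule exI[of _ "\<lambda>n w. s n w - t n w"])
      (auto intro!: simple_function_compose2[OF s(1) t(1)] s(2) t(2) tendsto_diff)
qed

subsection \<open>Minkowski's inequality\<close>

text \<open>Convexity at \<open>x / a\<close> and \<open>y / b\<close> with weights
  \<open>a / (a + b)\<close> and \<open>b / (a + b)\<close>. When \<open>a\<close> and
  \<open>b\<close> bound the two Bochner norms, the bracket integrates to at most 1, which is
  Minkowski's inequality.\<close>

lemma powr_add_le_weighted:
  fixes x y a b :: real
  assumes p: "1 \<le> p" and "0 \<le> x" "0 \<le> y" "0 < a" "0 < b"
  shows "(x + y) powr p
    \<le> (a + b) powr p * (a / (a + b) * (x powr p / a powr p) + b / (a + b) * (y powr p / b powr p))"
proof -
  define t where "t = b / (a + b)"
  have t: "0 \<le> t" "t \<le> 1" "1 - t = a / (a + b)" using assms by (auto simp: t_def field_simps)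
  have "(x + y) / (a + b) = (1 - t) * (x / a) + t * (y / b)"
    using assms unfolding t(3) by (simp add: t_def add_divide_distrib)
  then have "((x + y) / (a + b)) powr p \<le> (1 - t) * (x / a) powr p + t * (y / b) powr p"
    using convex_onD[OF convex_on_powr_nonneg[OF p], of t "x / a" "y / b"] t(1,2) assms by simp
  then have "(a + b) powr p * ((x + y) / (a + b)) powr p
      \<le> (a + b) powr p * ((1 - t) * (x / a) powr p + t * (y / b) powr p)"
    by (intro mult_left_mono) auto
  moreover have "(a + b) powr p * ((x + y) / (a + b)) powr p = (x + y) powr p"
    using assms by (simp flip: powr_mult)
  ultimately have "(x + y) powr p \<le> (a + b) powr p * ((1 - t) * (x / a) powr p + t * (y / b) powr p)"
    by simp
  then show ?thesis
    using assms unfolding t(3) unfolding t_def by (simp add: powr_divide)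
qed

lemma bochner_norm_nonneg: "0 \<le> bochner_norm M p f"
  by (simp add: bochner_norm_def)

lemma bochner_norm_powr:
  assumes "1 \<le> p"
  shows "bochner_norm M p f powr p = (\<integral>w. norm (f w) powr p \<partial>M)"
  using assms by (simp add: bochner_norm_def powr_powr)

lemma bochner_norm_le:
  assumes "1 \<le> p" "0 \<le> c" "(\<integral>w. norm (f w) powr p \<partial>M) \<le> c powr p"
  shows "bochner_norm M p f \<le> c"
proof -
  have "(\<integral>w. norm (f w) powr p \<partial>M) powr (1 / p) \<le> (c powr p) powr (1 / p)"
    using assms by (intro powr_mono2) auto
  then show ?thesis using assms by (simp add: bochner_norm_def powr_powr)
qed

lemma
  fixes f g :: "'w \<Rightarrow> 'a::real_normed_vector"
  assumes p: "1 \<le> p" and meas: "(\<lambda>w. norm (f w + g w)) \<in> borel_measurable M"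
    and f: "integrable M (\<lambda>w. norm (f w) powr p)" and g: "integrable M (\<lambda>w. norm (g w) powr p)"
  shows integrable_norm_powr_add: "integrable M (\<lambda>w. norm (f w + g w) powr p)"
    and bochner_norm_triangle:
      "bochner_norm M p (\<lambda>w. f w + g w) \<le> bochner_norm M p f + bochner_norm M p g"
proof -
  define W where "W a b w = (a + b) powr p *
      (a / (a + b) * (norm (f w) powr p / a powr p) + b / (a + b) * (norm (g w) powr p / b powr p))"
    for a b w
  have intW: "integrable M (W a b)" for a b
    unfolding W_def using f g by (intro integrable_mult_right integrable_add integrable_divide) auto
  have le: "norm (f w + g w) powr p \<le> W a b w" if "0 < a" "0 < b" for a b w
  proof -
    have "norm (f w + g w) powr p \<le> (norm (f w) + norm (g w)) powr p"
      using p by (intro powr_mono2 norm_triangle_ineq) auto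
    also have "\<dots> \<le> W a b w"
      unfolding W_def using that p by (intro powr_add_le_weighted) auto
    finally show ?thesis .
  qed
  have "(\<lambda>w. norm (f w + g w) powr p) \<in> borel_measurable M"
    using meas by measurable
  then show int: "integrable M (\<lambda>w. norm (f w + g w) powr p)"
    by (rule Bochner_Integration.integrable_bound[OF intW[of 1 1]])
      (use le[of 1 1] in \<open>auto intro!: AE_I2 intro: order_trans[OF _ abs_ge_self]\<close>)
  show "bochner_norm M p (\<lambda>w. f w + g w) \<le> bochner_norm M p f + bochner_norm M p g"
  proof (rule field_le_epsilon)
    fix \<epsilon> :: real assume "\<epsilon> > 0"
    \<comment> \<open>The margin \<open>\<epsilon> / 2\<close> keeps \<open>a\<close> and
      \<open>b\<close> positive when a norm vanishes.\<close>
    define a where "a = bochner_norm M p f + \<epsilon> / 2"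
    define b where "b = bochner_norm M p g + \<epsilon> / 2"
    have ab: "a > 0" "b > 0"
      using \<open>\<epsilon> > 0\<close> by (auto simp: a_def b_def intro: add_nonneg_pos bochner_norm_nonneg)
    have fa: "(\<integral>w. norm (f w) powr p \<partial>M) \<le> a powr p" and gb: "(\<integral>w. norm (g w) powr p \<partial>M) \<le> b powr p"
      unfolding bochner_norm_powr[OF p, symmetric] a_def b_def
      using p \<open>\<epsilon> > 0\<close> by (auto intro!: powr_mono2 bochner_norm_nonneg)
    have "(\<integral>w. norm (f w + g w) powr p \<partial>M) \<le> (\<integral>w. W a b w \<partial>M)"
      by (intro integral_mono int intW le ab)
    also have "\<dots> = (a + b) powr p * (a / (a + b) * ((\<integral>w. norm (f w) powr p \<partial>M) / a powr p)
        + b / (a + b) * ((\<integral>w. norm (g w) powr p \<partial>M) / b powr p))"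
      unfolding W_def using f g by simp
    also have "\<dots> \<le> (a + b) powr p * (a / (a + b) * 1 + b / (a + b) * 1)"
      using ab fa gb by (intro mult_left_mono add_mono) auto
    also have "\<dots> = (a + b) powr p" using ab by (simp flip: add_divide_distrib)
    finally have "bochner_norm M p (\<lambda>w. f w + g w) \<le> a + b"
      using ab p by (intro bochner_norm_le) auto
    then show "bochner_norm M p (\<lambda>w. f w + g w) \<le> bochner_norm M p f + bochner_norm M p g + \<epsilon>"
      by (simp add: a_def b_def)
  qed
qed

subsection \<open>Simple functions\<close>

text \<open>For \<open>\<sigma> = 1 - 1 / p\<close> the integrand of \<open>Phi\<close> becomes
  \<open>\<bar>x' v\<bar> * norm v powr (p - 1)\<close>, the kind of product that the domination by
  functionals leaves. It is at most \<open>norm v powr p\<close>, which makes the real supremum one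
  over a bounded set.\<close>

lemma (in finite_measure) Phi_ge:
  fixes f :: "'a \<Rightarrow> 'b::real_normed_vector"
  assumes p: "1 \<le> p" and f: "simple_function M f" and x': "norm x' \<le> 1"
  shows "(\<integral>w. \<bar>blinfun_apply x' (f w)\<bar> * norm (f w) powr (p - 1) \<partial>M) powr (1 / p) \<le> Phi M p (1 - 1 / p) f"
proof -
  have integrand: "(\<bar>y\<bar> powr (1 - (1 - 1 / p)) * norm v powr (1 - 1 / p)) powr p = \<bar>y\<bar> * norm v powr (p - 1)"
    for y :: real and v :: 'b
    using p by (simp add: powr_mult powr_powr left_diff_distrib)
  define F where "F x' = (\<integral>w. \<bar>blinfun_apply x' (f w)\<bar> * norm (f w) powr (p - 1) \<partial>M) powr (1 / p)"
    for x' :: "'b \<Rightarrow>\<^sub>L real"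
  have "F y \<le> (\<integral>w. norm (f w) powr p \<partial>M) powr (1 / p)" if "y \<in> cball 0 1" for y
  proof -
    have "\<bar>y v\<bar> * norm v powr (p - 1) \<le> norm v powr p" for v
    proof -
      have "\<bar>y v\<bar> \<le> norm y * norm v" using norm_blinfun[of y v] by simp
      also have "\<dots> \<le> 1 * norm v" using that by (intro mult_right_mono) auto
      finally have "\<bar>y v\<bar> * norm v powr (p - 1) \<le> norm v * norm v powr (p - 1)"
        by (intro mult_right_mono) auto
      then show ?thesis by (simp add: powr_mult_base)
    qed
    then show ?thesis
      unfolding F_def using p
      by (intro powr_mono2 integral_mono integrable_simple_compose[OF f] Bochner_Integration.integral_nonneg) auto
  qed
  then have "bdd_above (F ` cball 0 1)" by (intro bdd_aboveI2)
  moreover have "x' \<in> cball 0 1" using x' by simp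
  ultimately have "F x' \<le> (SUP x' \<in> cball 0 1. F x')" by (rule cSUP_upper[rotated])
  then show ?thesis unfolding Phi_def integrand F_def .
qed

lemma (in finite_measure) Phi_nonneg:
  assumes "1 \<le> p" and "simple_function M f"
  shows "0 \<le> Phi M p (1 - 1 / p) f"
  using Phi_ge[OF assms, of 0] by simp

lemma Phi_minus: "Phi M p \<sigma> (\<lambda>w. - f w) = Phi M p \<sigma> f"
  by (simp add: Phi_def blinfun.minus_right)

text \<open>The finitely many values of \<open>f\<close> span a space on which the domination by
  functionals holds. Each functional lies in the dual ball, so its integral is at most the
  \<open>p\<close>-th power of \<open>Phi\<close>, and the factor \<open>card I\<close> cancels. The
  functionals depend on \<open>f\<close>, the constant does not.\<close>

lemma (in finite_measure) bochner_norm_le_Phi: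
  fixes u :: "'h::real_inner \<Rightarrow>\<^sub>L 'h"
  assumes p: "1 \<le> p" and u: "approximable (2 * p) u" and f: "simple_function M f"
    and R: "R = sqrt (\<Sum>n. approx_number u (Suc n) powr (2 * p)) + 1"
  shows "bochner_norm M p (\<lambda>w. u (f w)) \<le> (3 * R) powr (1 / p) * Phi M p (1 - 1 / p) f"
proof -
  obtain I :: "nat set set" and y :: "nat set \<Rightarrow> 'h" where
    I: "finite I" "I \<noteq> {}" and y: "\<And>A. A \<in> I \<Longrightarrow> norm (y A) \<le> 1" and
    dom: "\<And>x. x \<in> span (f ` space M) \<Longrightarrow> real (card I) * norm (u x) powr p
       \<le> 3 * R * (\<Sum>A\<in>I. \<bar>x \<bullet> y A\<bar> * norm x powr (p - 1))"
    by (rule powr_norm_le_average_functionals[OF p u simple_functionD(1)[OF f] R]) (rule that)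
  have Phi0: "0 \<le> Phi M p (1 - 1 / p) f" using Phi_nonneg[OF p f] .
  have "0 \<le> suminf (\<lambda>n. approx_number u (Suc n) powr (2 * p))"
    using u by (intro suminf_nonneg) (auto simp: approximable_def)
  then have R0: "R > 0" unfolding R by (simp add: add_nonneg_pos)
  have int_le: "(\<integral>w. \<bar>f w \<bullet> y A\<bar> * norm (f w) powr (p - 1) \<partial>M) \<le> Phi M p (1 - 1 / p) f powr p"
    (is "?J \<le> _") if "A \<in> I" for A
  proof -
    have "norm (blinfun_inner_left (y A)) \<le> 1"
      using y[OF that] Cauchy_Schwarz_ineq2[of _ "y A"] mult_right_mono[OF y[OF that] norm_ge_zero]
      by (intro norm_blinfun_bound) (auto simp: mult.commute intro: order_trans)
    from Phi_ge[OF p f this] have "(?J powr (1 / p)) powr p \<le> Phi M p (1 - 1 / p) f powr p"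
      using p by (intro powr_mono2) auto
    moreover have "0 \<le> ?J" by (intro Bochner_Integration.integral_nonneg) auto
    ultimately show ?thesis using p by (simp add: powr_powr)
  qed
  have "real (card I) * (\<integral>w. norm (u (f w)) powr p \<partial>M) = (\<integral>w. real (card I) * norm (u (f w)) powr p \<partial>M)"
    by simp
  also have "\<dots> \<le> (\<integral>w. 3 * R * (\<Sum>A\<in>I. \<bar>f w \<bullet> y A\<bar> * norm (f w) powr (p - 1)) \<partial>M)"
    using dom by (intro integral_mono integrable_simple_compose[OF f]) (auto intro: span_base)
  also have "\<dots> = 3 * R * (\<Sum>A\<in>I. (\<integral>w. \<bar>f w \<bullet> y A\<bar> * norm (f w) powr (p - 1) \<partial>M))"
    by (subst integral_mult_right_zero, subst Bochner_Integration.integral_sum)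
      (auto intro: integrable_simple_compose[OF f, of "\<lambda>v. \<bar>v \<bullet> y _\<bar> * norm v powr (p - 1)"])
  also have "\<dots> \<le> 3 * R * (\<Sum>A\<in>I. Phi M p (1 - 1 / p) f powr p)"
    using R0 by (intro mult_left_mono sum_mono int_le) auto
  also have "\<dots> = real (card I) * (3 * R * Phi M p (1 - 1 / p) f powr p)" by simp
  finally have "(\<integral>w. norm (u (f w)) powr p \<partial>M) \<le> 3 * R * Phi M p (1 - 1 / p) f powr p"
    using I by (simp add: card_gt_0_iff)
  also have "\<dots> = ((3 * R) powr (1 / p) * Phi M p (1 - 1 / p) f) powr p"
    using p R0 by (simp add: powr_mult powr_powr)
  finally show ?thesis
    using p Phi0 by (intro bochner_norm_le) auto
qed

lemma simple_function_sum_vector: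
  fixes g :: "nat \<Rightarrow> 'w \<Rightarrow> 'a::real_normed_vector"
  assumes "\<And>i. i < n \<Longrightarrow> simple_function M (g i)"
  shows "simple_function M (\<lambda>w. \<Sum>i<n. g i w)"
  using assms
proof (induction n)
  case (Suc n)
  then show ?case
    using simple_function_compose2[of M "\<lambda>w. \<Sum>i<n. g i w" "g n" "(+)"] by simp
qed simp

lemma (in finite_measure) bochner_norm_sum:
  fixes u :: "'b::real_normed_vector \<Rightarrow>\<^sub>L 'c::real_normed_vector" and n :: nat
  assumes p: "1 \<le> p" and "\<And>i. i < n \<Longrightarrow> simple_function M (g i)"
  shows "bochner_norm M p (\<lambda>w. u (\<Sum>i<n. g i w)) \<le> (\<Sum>i<n. bochner_norm M p (\<lambda>w. u (g i w)))"
  using assms(2)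
proof (induction n)
  case 0
  then show ?case using p by (simp add: bochner_norm_def blinfun.zero_right)
next
  case (Suc n)
  have s: "simple_function M (\<lambda>w. \<Sum>i<n. g i w)" "simple_function M (g n)"
    using Suc.prems by (auto intro: simple_function_sum_vector)
  have "simple_function M (\<lambda>w. norm (u (\<Sum>i<n. g i w) + u (g n w)))"
    by (rule simple_function_compose2[OF s, of "\<lambda>a b. norm (u a + u b)"])
  then have "bochner_norm M p (\<lambda>w. u (\<Sum>i<n. g i w) + u (g n w))
      \<le> bochner_norm M p (\<lambda>w. u (\<Sum>i<n. g i w)) + bochner_norm M p (\<lambda>w. u (g n w))"
    by (intro bochner_norm_triangle[OF p] borel_measurable_simple_function
        integrable_simple_compose[OF s(1)] integrable_simple_compose[OF s(2)])
  then show ?case using Suc by (simp add: blinfun.add_right)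
qed

text \<open>The Bochner norm is subadditive, so the bound by \<open>Phi\<close> adds up over any
  decomposition and passes to the infimum.\<close>

lemma (in finite_measure) bochner_norm_le_simple_psigma_norm:
  fixes u :: "'h::real_inner \<Rightarrow>\<^sub>L 'h"
  assumes p: "1 \<le> p" and u: "approximable (2 * p) u" and f: "simple_function M f"
    and C: "C = (3 * (sqrt (\<Sum>n. approx_number u (Suc n) powr (2 * p)) + 1)) powr (1 / p)"
  shows "bochner_norm M p (\<lambda>w. u (f w)) \<le> C * simple_psigma_norm M p (1 - 1 / p) f"
proof -
  have "0 \<le> suminf (\<lambda>n. approx_number u (Suc n) powr (2 * p))"
    using u by (intro suminf_nonneg) (auto simp: approximable_def)
  then have "sqrt (\<Sum>n. approx_number u (Suc n) powr (2 * p)) + 1 > 0" by (simp add: add_nonneg_pos)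
  then have C0: "C > 0" unfolding C by simp
  have "bochner_norm M p (\<lambda>w. u (f w)) / C \<le> simple_psigma_norm M p (1 - 1 / p) f"
    unfolding simple_psigma_norm_def
  proof (rule cInf_greatest)
    show "{\<Sum>i<n. Phi M p (1 - 1 / p) (g i) | (n :: nat) g.
        (\<forall>i<n. simple_function M (g i)) \<and> (AE w in M. f w = (\<Sum>i<n. g i w))} \<noteq> {}"
      using f by (auto intro!: exI[of _ "Suc 0"] exI[of _ "\<lambda>_. f"])
  next
    fix r assume "r \<in> {\<Sum>i<n. Phi M p (1 - 1 / p) (g i) | (n :: nat) g.
        (\<forall>i<n. simple_function M (g i)) \<and> (AE w in M. f w = (\<Sum>i<n. g i w))}"
    then obtain n :: nat and g where r: "r = (\<Sum>i<n. Phi M p (1 - 1 / p) (g i))"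
      and g: "\<And>i. i < n \<Longrightarrow> simple_function M (g i)" and eq: "AE w in M. f w = (\<Sum>i<n. g i w)"
      by auto
    have "(\<integral>w. norm (u (f w)) powr p \<partial>M) = (\<integral>w. norm (u (\<Sum>i<n. g i w)) powr p \<partial>M)"
      using eq by (intro integral_cong_AE borel_measurable_integrable integrable_simple_compose[OF f]
          integrable_simple_compose[OF simple_function_sum_vector[OF g]]) auto
    then have "bochner_norm M p (\<lambda>w. u (f w)) = bochner_norm M p (\<lambda>w. u (\<Sum>i<n. g i w))"
      by (simp add: bochner_norm_def)
    also have "\<dots> \<le> (\<Sum>i<n. bochner_norm M p (\<lambda>w. u (g i w)))"
      by (intro bochner_norm_sum p g)
    also have "\<dots> \<le> (\<Sum>i<n. C * Phi M p (1 - 1 / p) (g i))"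
      unfolding C using g by (intro sum_mono bochner_norm_le_Phi[OF p u _ refl]) auto
    finally show "bochner_norm M p (\<lambda>w. u (f w)) / C \<le> r"
      using C0 by (simp add: r divide_le_eq mult.commute flip: sum_distrib_left)
  qed
  then show ?thesis using C0 by (simp add: divide_le_eq mult.commute)
qed

section \<open>Triangle inequalities for the norm on simple functions\<close>

lemma (in finite_measure) simple_psigma_norm_le:
  fixes n :: nat
  assumes p: "1 \<le> p" and "\<And>i. i < n \<Longrightarrow> simple_function M (g i)"
    and "AE w in M. f w = (\<Sum>i<n. g i w)"
  shows "simple_psigma_norm M p (1 - 1 / p) f \<le> (\<Sum>i<n. Phi M p (1 - 1 / p) (g i))"
  unfolding simple_psigma_norm_def
proof (rule cInf_lower)
  show "bdd_below {\<Sum>i<n. Phi M p (1 - 1 / p) (g i) | (n :: nat) g.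
      (\<forall>i<n. simple_function M (g i)) \<and> (AE w in M. f w = (\<Sum>i<n. g i w))}"
    using Phi_nonneg[OF p] by (intro bdd_belowI[of _ 0]) (auto intro!: sum_nonneg)
qed (use assms in auto)

text \<open>Decompositions of \<open>f\<close> and of the negative of \<open>g\<close> concatenate
  to one of the difference, and \<open>Phi\<close> ignores signs.\<close>

lemma (in finite_measure) simple_psigma_norm_diff_le:
  fixes f g :: "'a \<Rightarrow> 'b::real_normed_vector"
  assumes p: "1 \<le> p" and f: "simple_function M f" and g: "simple_function M g"
  shows "simple_psigma_norm M p (1 - 1 / p) (\<lambda>w. f w - g w)
    \<le> simple_psigma_norm M p (1 - 1 / p) f + simple_psigma_norm M p (1 - 1 / p) g"
proof -
  define D where "D h = {\<Sum>i<n. Phi M p (1 - 1 / p) (k i) | (n :: nat) k.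
      (\<forall>i<n. simple_function M (k i)) \<and> (AE w in M. h w = (\<Sum>i<n. k i w))}" for h :: "'a \<Rightarrow> 'b"
  let ?N = "simple_psigma_norm M p (1 - 1 / p) :: ('a \<Rightarrow> 'b) \<Rightarrow> real"
  have N: "?N h = Inf (D h)" for h by (simp add: simple_psigma_norm_def D_def)
  have ne: "D h \<noteq> {}" if "simple_function M h" for h
    using that unfolding D_def by (auto intro!: exI[of _ "Suc 0"] exI[of _ "\<lambda>_. h"])
  have le: "?N (\<lambda>w. f w - g w) \<le> a + b" if a: "a \<in> D f" and b: "b \<in> D g" for a b
  proof -
    obtain n :: nat and k where nk: "a = (\<Sum>i<n. Phi M p (1 - 1 / p) (k i))"
      "\<And>i. i < n \<Longrightarrow> simple_function M (k i)" "AE w in M. f w = (\<Sum>i<n. k i w)"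
      using a unfolding D_def by auto
    obtain m :: nat and l where ml: "b = (\<Sum>i<m. Phi M p (1 - 1 / p) (l i))"
      "\<And>i. i < m \<Longrightarrow> simple_function M (l i)" "AE w in M. g w = (\<Sum>i<m. l i w)"
      using b unfolding D_def by auto
    define q where "q i = (if i < n then k i else (\<lambda>w. - l (i - n) w))" for i
    have split: "(\<Sum>i<n + m. c i) = (\<Sum>i<n. c i) + (\<Sum>i<m. c (n + i))" for c :: "nat \<Rightarrow> 'z::comm_monoid_add"
      by (induction m) (simp_all add: add.assoc)
    have "?N (\<lambda>w. f w - g w) \<le> (\<Sum>i<n + m. Phi M p (1 - 1 / p) (q i))"
    proof (rule simple_psigma_norm_le[OF p])
      show "simple_function M (q i)" if "i < n + m" for i
        using nk(2) simple_function_compose1[OF ml(2), of "i - n" uminus] that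
        by (auto simp: q_def)
      show "AE w in M. f w - g w = (\<Sum>i<n + m. q i w)"
        using nk(3) ml(3) by eventually_elim (simp add: split q_def sum_negf)
    qed
    also have "\<dots> = a + b" by (simp add: split q_def nk(1) ml(1) Phi_minus)
    finally show ?thesis .
  qed
  have "?N (\<lambda>w. f w - g w) - b \<le> ?N f" if "b \<in> D g" for b
    unfolding N[of f] using le[OF _ that] by (intro cInf_greatest ne f) (simp add: algebra_simps)
  then have "?N (\<lambda>w. f w - g w) - ?N f \<le> ?N g"
    unfolding N[of g] by (intro cInf_greatest ne g) (simp add: algebra_simps)
  then show ?thesis by simp
qed

text \<open>The empty decomposition has sum 0.\<close>

lemma (in finite_measure) simple_psigma_norm_zero_le:
  assumes "1 \<le> p"
  shows "simple_psigma_norm M p (1 - 1 / p) (\<lambda>_. 0) \<le> 0"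
  by (simp add: simple_psigma_norm_le[OF assms, of 0, simplified])

text \<open>The reverse triangle inequality, from \<open>f = (f - g) - (0 - g)\<close>.\<close>

lemma (in finite_measure) simple_psigma_norm_diff_ge:
  fixes f g :: "'a \<Rightarrow> 'b::real_normed_vector"
  assumes p: "1 \<le> p" and f: "simple_function M f" and g: "simple_function M g"
  shows "simple_psigma_norm M p (1 - 1 / p) f - simple_psigma_norm M p (1 - 1 / p) g
    \<le> simple_psigma_norm M p (1 - 1 / p) (\<lambda>w. f w - g w)"
proof -
  have fg: "simple_function M (\<lambda>w. f w - g w)" and mg: "simple_function M (\<lambda>w. 0 - g w)"
    using f g by (auto intro: simple_function_compose2 simple_function_compose1[of M g "\<lambda>x. 0 - x"])
  show ?thesis
    using simple_psigma_norm_diff_le[OF p fg mg] simple_psigma_norm_diff_le[OF p _ g, of "\<lambda>_. 0"]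
      simple_psigma_norm_zero_le[OF p, where ?'b = 'b] by simp
qed

subsection \<open>Passage to the limit\<close>

text \<open>A class that contains the simple functions and \<open>pettis_space\<close> and is stable
  under differences, so that approximation errors such as \<open>s n w - f w\<close> stay inside
  it.\<close>

definition weakly_Lp :: "'w measure \<Rightarrow> real \<Rightarrow> ('w \<Rightarrow> 'a::real_normed_vector) \<Rightarrow> bool" where
  "weakly_Lp M p f \<longleftrightarrow> strongly_measurable M f \<and>
     (\<forall>x' :: 'a \<Rightarrow>\<^sub>L real. integrable M (\<lambda>w. \<bar>x' (f w)\<bar> powr p))"

lemma pettis_space_weakly_Lp: "f \<in> pettis_space M p \<Longrightarrow> weakly_Lp M p f"
  by (simp add: pettis_space_def weakly_Lp_def)

lemma (in finite_measure) simple_function_weakly_Lp: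
  assumes "simple_function M f"
  shows "weakly_Lp M p f"
  using assms integrable_simple_compose[OF assms] unfolding weakly_Lp_def strongly_measurable_def
  by (auto intro!: exI[of _ "\<lambda>_. f"])

lemma
  fixes f g :: "'w \<Rightarrow> 'a::real_normed_vector" and x' :: "'a \<Rightarrow>\<^sub>L real"
  assumes p: "1 \<le> p" and f: "weakly_Lp M p f" and g: "weakly_Lp M p g"
  shows weakly_Lp_diff: "weakly_Lp M p (\<lambda>w. f w - g w)"
    and bochner_norm_blinfun_diff: "bochner_norm M p (\<lambda>w. x' (f w - g w))
      \<le> bochner_norm M p (\<lambda>w. x' (f w)) + bochner_norm M p (\<lambda>w. x' (g w))"
proof -
  have sm: "strongly_measurable M (\<lambda>w. f w - g w)"
    using f g by (simp add: weakly_Lp_def strongly_measurable_diff)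
  have meas: "(\<lambda>w. norm (y (f w) + - y (g w))) \<in> borel_measurable M" for y :: "'a \<Rightarrow>\<^sub>L real"
    using strongly_measurable_compose[OF sm, of "\<lambda>v. norm (y v)"]
    by (simp add: blinfun.diff_right continuous_intros)
  have int: "integrable M (\<lambda>w. norm (y (f w)) powr p)" "integrable M (\<lambda>w. norm (- y (g w)) powr p)"
    for y :: "'a \<Rightarrow>\<^sub>L real"
    using f g by (auto simp: weakly_Lp_def)
  show "weakly_Lp M p (\<lambda>w. f w - g w)"
    using sm integrable_norm_powr_add[OF p meas int] by (simp add: weakly_Lp_def blinfun.diff_right)
  show "bochner_norm M p (\<lambda>w. x' (f w - g w))
      \<le> bochner_norm M p (\<lambda>w. x' (f w)) + bochner_norm M p (\<lambda>w. x' (g w))"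
    using bochner_norm_triangle[OF p meas int, of x'] by (simp add: blinfun.diff_right bochner_norm_def)
qed

text \<open>Makes Minkowski's inequality for scalar functions available for
  \<open>pettis_norm\<close>.\<close>

lemma pettis_norm_eq:
  "pettis_norm M p f = (SUP x' \<in> cball (0 :: 'a::real_normed_vector \<Rightarrow>\<^sub>L real) 1.
     ennreal (bochner_norm M p (\<lambda>w. blinfun_apply x' (f w))))"
  by (simp add: pettis_norm_def bochner_norm_def)

lemma pettis_norm_diff_le:
  assumes "1 \<le> p" "weakly_Lp M p f" "weakly_Lp M p g"
  shows "pettis_norm M p (\<lambda>w. f w - g w) \<le> pettis_norm M p f + pettis_norm M p g"
  unfolding pettis_norm_eq[of _ _ "\<lambda>w. f w - g w"]
proof (rule SUP_least)
  fix x' :: "'b \<Rightarrow>\<^sub>L real" assume x': "x' \<in> cball 0 1"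
  have "ennreal (bochner_norm M p (\<lambda>w. x' (f w - g w)))
      \<le> ennreal (bochner_norm M p (\<lambda>w. x' (f w)) + bochner_norm M p (\<lambda>w. x' (g w)))"
    by (intro ennreal_leI bochner_norm_blinfun_diff assms)
  also have "\<dots> = ennreal (bochner_norm M p (\<lambda>w. x' (f w))) + ennreal (bochner_norm M p (\<lambda>w. x' (g w)))"
    by (simp add: bochner_norm_nonneg)
  also have "\<dots> \<le> pettis_norm M p f + pettis_norm M p g"
    unfolding pettis_norm_eq using x' by (intro add_mono SUP_upper)
  finally show "ennreal (bochner_norm M p (\<lambda>w. x' (f w - g w))) \<le> pettis_norm M p f + pettis_norm M p g" .
qed

text \<open>Since \<open>pettis_norm\<close> is uniform over the dual ball, one rapidly convergent subsequence serves
  all functionals at once; only the exceptional null set depends on the functional.\<close>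

lemma (in finite_measure) pettis_norm_AE_subseq:
  fixes f :: "'a \<Rightarrow> 'b::real_normed_vector"
  assumes p: "1 \<le> p" and s: "\<And>n. simple_function M (s n)" and f: "weakly_Lp M p f"
    and lim: "(\<lambda>n. pettis_norm M p (\<lambda>w. s n w - f w)) \<longlonglongrightarrow> 0"
  obtains r :: "nat \<Rightarrow> nat" where "\<And>k. k \<le> r k"
    "\<And>x' :: 'b \<Rightarrow>\<^sub>L real. AE w in M. (\<lambda>k. x' (s (r k) w)) \<longlonglongrightarrow> x' (f w)"
proof -
  have "\<exists>n\<ge>k. pettis_norm M p (\<lambda>w. s n w - f w) < ennreal ((1/2)^k)" for k :: nat
  proof -
    have "eventually (\<lambda>n. pettis_norm M p (\<lambda>w. s n w - f w) < ennreal ((1/2)^k)) sequentially"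
      by (rule order_tendstoD(2)[OF lim]) simp
    then show ?thesis
      using eventually_ge_at_top[of k] eventually_happens'[OF sequentially_bot eventually_conj] by blast
  qed
  then obtain r :: "nat \<Rightarrow> nat" where r: "\<And>k. k \<le> r k"
    "\<And>k. pettis_norm M p (\<lambda>w. s (r k) w - f w) < ennreal ((1/2)^k)" by metis
  have "AE w in M. (\<lambda>k. x' (s (r k) w)) \<longlonglongrightarrow> x' (f w)" for x' :: "'b \<Rightarrow>\<^sub>L real"
  proof -
    \<comment> \<open>Dividing by \<open>c\<close> moves \<open>x'\<close> into the dual ball; the
      summand 1 covers \<open>x' = 0\<close>.\<close>
    define c where "c = norm x' + 1"
    have c: "c > 0" by (simp add: c_def add_nonneg_pos)
    define y where "y = x' /\<^sub>R c"
    have y: "y \<in> cball 0 1" using c by (simp add: y_def c_def divide_simps)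
    define h where "h k w = \<bar>y (s (r k) w - f w)\<bar> powr p" for k w
    have int: "integrable M (h k)" for k
      using weakly_Lp_diff[OF p simple_function_weakly_Lp[OF s] f] by (simp add: weakly_Lp_def h_def[abs_def])
    have h0: "0 \<le> h k w" for k w by (simp add: h_def)
    have int_le: "(\<integral>w. h k w \<partial>M) \<le> (1/2)^k" for k
    proof -
      have "ennreal (bochner_norm M p (\<lambda>w. y (s (r k) w - f w))) \<le> pettis_norm M p (\<lambda>w. s (r k) w - f w)"
        unfolding pettis_norm_eq using y by (rule SUP_upper)
      also have "\<dots> < ennreal ((1/2)^k)" by (rule r)
      finally have b: "bochner_norm M p (\<lambda>w. y (s (r k) w - f w)) \<le> (1/2)^k"
        by (simp add: ennreal_less_iff bochner_norm_nonneg)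
      have "(\<integral>w. h k w \<partial>M) = bochner_norm M p (\<lambda>w. y (s (r k) w - f w)) powr p"
        by (simp add: bochner_norm_powr[OF p] h_def)
      also have "\<dots> \<le> ((1/2)^k) powr p"
        using b p by (intro powr_mono2) (auto simp: bochner_norm_nonneg)
      also have "\<dots> \<le> ((1/2)^k) powr 1"
        using p by (intro powr_mono') (auto simp: power_le_one)
      finally show ?thesis by simp
    qed
    \<comment> \<open>The integrals of \<open>h k\<close> are summable, so the series of the
      \<open>h k\<close> converges almost everywhere and its terms tend to 0.\<close>
    have "(\<integral>\<^sup>+w. (\<Sum>k. ennreal (h k w)) \<partial>M) = (\<Sum>k. \<integral>\<^sup>+w. ennreal (h k w) \<partial>M)"
      using int by (intro nn_integral_suminf) auto
    also have "\<dots> \<le> (\<Sum>k. ennreal ((1/2)^k))"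
      using int_le int h0 by (intro suminf_le) (auto simp: nn_integral_eq_integral ennreal_leI)
    also have "\<dots> = ennreal (\<Sum>k. (1/2)^k)"
      by (intro suminf_ennreal2) (auto intro: summable_geometric)
    also have "\<dots> < \<infinity>" by simp
    finally have "(\<integral>\<^sup>+w. (\<Sum>k. ennreal (h k w)) \<partial>M) \<noteq> \<infinity>" by simp
    moreover have "(\<lambda>w. \<Sum>k. ennreal (h k w)) \<in> borel_measurable M"
      using int by (intro borel_measurable_suminf_order) auto
    ultimately have "AE w in M. (\<Sum>k. ennreal (h k w)) \<noteq> \<infinity>"
      by (intro nn_integral_PInf_AE)
    then show ?thesis
    proof eventually_elim
      case (elim w)
      have "summable (\<lambda>k. h k w)"
        using elim h0 by (intro summable_suminf_not_top) auto
      then have "(\<lambda>k. h k w) \<longlonglongrightarrow> 0" by (rule summable_LIMSEQ_zero)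
      then have "(\<lambda>k. h k w powr (1 / p)) \<longlonglongrightarrow> 0"
        using p h0 by (intro tendsto_zero_powrI[of _ _ _ "1 / p"]) auto
      then have "(\<lambda>k. c * \<bar>y (s (r k) w - f w)\<bar>) \<longlonglongrightarrow> 0"
        using p by (intro tendsto_mult_right_zero) (simp add: h_def powr_powr)
      moreover have "c * \<bar>y v\<bar> = \<bar>x' v\<bar>" for v
        using c by (simp add: y_def blinfun.scaleR_left abs_mult)
      ultimately have "(\<lambda>k. \<bar>x' (s (r k) w - f w)\<bar>) \<longlonglongrightarrow> 0" by (simp only:)
      then show ?case by (simp add: tendsto_rabs_zero_iff blinfun.diff_right LIM_zero_iff)
    qed
  qed
  with r(1) show thesis by (rule that)
qed

text \<open>Weak lower semicontinuity of the norm, tested only on a sequence \<open>d\<close>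
  converging to \<open>z\<close>: if \<open>c < norm z\<close>, some \<open>d k\<close> already
  satisfies \<open>c * norm (d k) < z \<bullet> d k\<close>. Countably many test vectors suffice,
  which suits convergence off null sets.\<close>

lemma norm_powr_le_liminf:
  fixes z :: "'a::real_inner"
  assumes p: "1 \<le> p" and weak: "\<And>k. (\<lambda>n. a n \<bullet> d k) \<longlonglongrightarrow> z \<bullet> d k" and d: "d \<longlonglongrightarrow> z"
  shows "ennreal (norm z powr p) \<le> liminf (\<lambda>n. ennreal (norm (a n) powr p))"
  unfolding le_Liminf_iff
proof (intro allI impI)
  fix y assume y: "y < ennreal (norm z powr p)"
  then obtain b where b: "y = ennreal b" "0 \<le> b" by (cases y) auto
  with y have "b < norm z powr p" by (simp add: ennreal_less_iff)
  define c where "c = b powr (1 / p)"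
  have c: "0 \<le> c" "b = c powr p" using p b by (simp_all add: c_def powr_powr)
  then have cz: "c < norm z"
    using \<open>b < _\<close> p by (metis leD leI norm_ge_zero order_trans powr_mono2 zero_le_one)
  have "(\<lambda>k. z \<bullet> d k - c * norm (d k)) \<longlonglongrightarrow> z \<bullet> z - c * norm z"
    by (intro tendsto_intros d)
  moreover have "z \<bullet> z - c * norm z > 0"
  proof -
    have "0 < (norm z - c) * norm z" using cz c(1) by (intro mult_pos_pos) auto
    then show ?thesis by (simp add: dot_square_norm power2_eq_square algebra_simps)
  qed
  ultimately have "eventually (\<lambda>k. z \<bullet> d k - c * norm (d k) > 0) sequentially"
    by (rule order_tendstoD)
  then obtain k where "c * norm (d k) < z \<bullet> d k"
    using eventually_happens'[OF sequentially_bot] by fastforce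
  then have "eventually (\<lambda>n. c * norm (d k) < a n \<bullet> d k) sequentially"
    by (rule order_tendstoD(1)[OF weak])
  then show "eventually (\<lambda>n. y < ennreal (norm (a n) powr p)) sequentially"
  proof eventually_elim
    case (elim n)
    also have "a n \<bullet> d k \<le> norm (a n) * norm (d k)" by (rule norm_cauchy_schwarz)
    finally have "c < norm (a n)" by (rule mult_right_less_imp_less) simp
    then have "c powr p < norm (a n) powr p" using c p by (intro powr_less_mono2) auto
    then show ?case using b(2) c(2) by (simp add: b(1) ennreal_less_iff)
  qed
qed

text \<open>By the reverse triangle inequality the norms form a Cauchy sequence, so the
  \<open>lim\<close> in \<open>psigma_norm\<close> is a genuine limit.\<close>

lemma (in finite_measure) simple_psigma_norm_convergent:
  assumes p: "1 \<le> p" and s: "psigma_approximating M p (1 - 1 / p) s f"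
  shows "convergent (\<lambda>n. simple_psigma_norm M p (1 - 1 / p) (s n))"
proof (rule Cauchy_convergent, rule metric_CauchyI)
  fix e :: real assume "e > 0"
  then obtain N where N: "\<And>m n. m \<ge> N \<Longrightarrow> n \<ge> N \<Longrightarrow>
      simple_psigma_norm M p (1 - 1 / p) (\<lambda>w. s m w - s n w) < e"
    using s unfolding psigma_approximating_def by blast
  have simple: "simple_function M (s n)" for n
    using s by (simp add: psigma_approximating_def)
  show "\<exists>N. \<forall>m\<ge>N. \<forall>n\<ge>N. dist (simple_psigma_norm M p (1 - 1 / p) (s m))
      (simple_psigma_norm M p (1 - 1 / p) (s n)) < e"
  proof (intro exI[of _ N] allI impI)
    fix m n assume mn: "m \<ge> N" "n \<ge> N"
    show "dist (simple_psigma_norm M p (1 - 1 / p) (s m)) (simple_psigma_norm M p (1 - 1 / p) (s n)) < e"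
      using simple_psigma_norm_diff_ge[OF p simple[of m] simple[of n]]
        simple_psigma_norm_diff_ge[OF p simple[of n] simple[of m]] N[OF mn] N[OF mn(2,1)]
      by (simp add: dist_real_def)
  qed
qed

text \<open>The bound for simple functions survives the limit: weak convergence along a subsequence
  bounds the integrand by a lower limit almost everywhere, and Fatou's lemma integrates
  this.\<close>

lemma (in finite_measure)
  fixes u :: "'h::real_inner \<Rightarrow>\<^sub>L 'h"
  assumes p: "1 \<le> p" and u: "approximable (2 * p) u" and f: "weakly_Lp M p f"
    and s: "psigma_approximating M p (1 - 1 / p) s f"
    and C: "C = (3 * (sqrt (\<Sum>n. approx_number u (Suc n) powr (2 * p)) + 1)) powr (1 / p)"
  shows comp_in_bochner_space: "(\<lambda>w. u (f w)) \<in> bochner_space M p"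
    and bochner_norm_comp_le:
      "bochner_norm M p (\<lambda>w. u (f w)) \<le> C * lim (\<lambda>n. simple_psigma_norm M p (1 - 1 / p) (s n))"
proof -
  let ?N = "\<lambda>n. simple_psigma_norm M p (1 - 1 / p) (s n)"
  have simple: "\<And>n. simple_function M (s n)"
    and plim: "(\<lambda>n. pettis_norm M p (\<lambda>w. s n w - f w)) \<longlonglongrightarrow> 0"
    using s by (auto simp: psigma_approximating_def)
  obtain r :: "nat \<Rightarrow> nat" where r: "\<And>k. k \<le> r k"
    and weak: "\<And>x' :: 'h \<Rightarrow>\<^sub>L real. AE w in M. (\<lambda>k. x' (s (r k) w)) \<longlonglongrightarrow> x' (f w)"
    by (rule pettis_norm_AE_subseq[OF p simple f plim]) (rule that)
  have sm: "strongly_measurable M f" using f by (simp add: weakly_Lp_def)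
  then obtain t where t: "\<And>n. simple_function M (t n)" "\<And>w. w \<in> space M \<Longrightarrow> (\<lambda>n. t n w) \<longlonglongrightarrow> f w"
    unfolding strongly_measurable_def by blast
  \<comment> \<open>A countable set of test vectors: the exceptional null sets unite to a null set,
    and at each point \<open>w\<close> the values \<open>t k w\<close> in \<open>D\<close> converge
    to \<open>f w\<close>.\<close>
  define D where "D = (\<Union>n. t n ` space M)"
  have "countable D" unfolding D_def
    using simple_functionD(1)[OF t(1)] by (intro countable_UN) (auto intro: countable_finite)
  moreover have "AE w in M. (\<lambda>k. u (s (r k) w) \<bullet> u v) \<longlonglongrightarrow> u (f w) \<bullet> u v" for v
    using weak[of "blinfun_inner_left (u v) o\<^sub>L u"] by simp
  ultimately have "AE w in M. \<forall>v\<in>D. (\<lambda>k. u (s (r k) w) \<bullet> u v) \<longlonglongrightarrow> u (f w) \<bullet> u v"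
    by (simp add: AE_ball_countable)
  then have lower: "AE w in M. ennreal (norm (u (f w)) powr p)
      \<le> liminf (\<lambda>k. ennreal (norm (u (s (r k) w)) powr p))"
    using AE_space
  proof eventually_elim
    case (elim w)
    show ?case
    proof (rule norm_powr_le_liminf[OF p, where d = "\<lambda>k. u (t k w)"])
      show "(\<lambda>n. u (s (r n) w) \<bullet> u (t k w)) \<longlonglongrightarrow> u (f w) \<bullet> u (t k w)" for k
        using elim by (auto simp: D_def)
      show "(\<lambda>k. u (t k w)) \<longlonglongrightarrow> u (f w)"
        using t(2)[of w] elim by (auto intro: blinfun.tendsto)
    qed
  qed
  have int_s: "integrable M (\<lambda>w. norm (u (s n w)) powr p)" for n
    by (rule integrable_simple_compose[OF simple])
  obtain L where L: "?N \<longlonglongrightarrow> L"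
    using simple_psigma_norm_convergent[OF p s] by (auto simp: convergent_def)
  \<comment> \<open>\<open>r\<close> may fail to be monotone, but tending to infinity is enough to
    keep the limit \<open>L\<close>.\<close>
  have filt: "filterlim r at_top sequentially"
    by (rule filterlim_at_top_mono[OF filterlim_ident]) (simp add: r)
  have Lr: "(\<lambda>k. ?N (r k)) \<longlonglongrightarrow> L"
    by (rule filterlim_compose[OF L filt])
  have le: "bochner_norm M p (\<lambda>w. u (s n w)) \<le> C * ?N n" for n
    by (rule bochner_norm_le_simple_psigma_norm[OF p u simple C])
  have nn: "0 \<le> C * ?N n" for n
    using le[of n] bochner_norm_nonneg order_trans by blast
  have CL: "0 \<le> C * L"
    by (rule LIMSEQ_le_const[of "\<lambda>n. C * ?N n"]) (auto intro!: tendsto_intros L nn)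
  have nnint: "(\<integral>\<^sup>+w. ennreal (norm (u (s n w)) powr p) \<partial>M) \<le> ennreal ((C * ?N n) powr p)" for n
  proof -
    have "(\<integral>\<^sup>+w. ennreal (norm (u (s n w)) powr p) \<partial>M) = ennreal (bochner_norm M p (\<lambda>w. u (s n w)) powr p)"
      using int_s by (simp add: nn_integral_eq_integral bochner_norm_powr[OF p])
    also have "\<dots> \<le> ennreal ((C * ?N n) powr p)"
      using le p by (intro ennreal_leI powr_mono2) (auto simp: bochner_norm_nonneg)
    finally show ?thesis .
  qed
  have "(\<integral>\<^sup>+w. ennreal (norm (u (f w)) powr p) \<partial>M)
      \<le> (\<integral>\<^sup>+w. liminf (\<lambda>k. ennreal (norm (u (s (r k) w)) powr p)) \<partial>M)"
    by (rule nn_integral_mono_AE[OF lower])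
  also have "\<dots> \<le> liminf (\<lambda>k. \<integral>\<^sup>+w. ennreal (norm (u (s (r k) w)) powr p) \<partial>M)"
    using int_s by (intro nn_integral_liminf) auto
  also have "\<dots> \<le> liminf (\<lambda>k. ennreal ((C * ?N (r k)) powr p))"
    by (intro Liminf_mono always_eventually allI nnint)
  also have "\<dots> = ennreal ((C * L) powr p)"
    using p nn by (intro lim_imp_Liminf tendsto_ennrealI tendsto_powr' tendsto_intros Lr) auto
  finally have bound: "(\<integral>\<^sup>+w. ennreal (norm (u (f w)) powr p) \<partial>M) \<le> ennreal ((C * L) powr p)" .
  have smu: "strongly_measurable M (\<lambda>w. u (f w))" using sm by (rule strongly_measurable_blinfun)
  have "(\<lambda>w. norm (u (f w))) \<in> borel_measurable M"
    by (rule strongly_measurable_compose[OF smu]) (intro continuous_intros)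
  then have int: "integrable M (\<lambda>w. norm (u (f w)) powr p)"
    using bound by (intro integrableI_nonneg) (auto simp: top.not_eq_extremum intro: le_less_trans)
  then show "(\<lambda>w. u (f w)) \<in> bochner_space M p"
    using smu by (simp add: bochner_space_def)
  have "(\<integral>w. norm (u (f w)) powr p \<partial>M) \<le> (C * L) powr p"
    using bound int by (simp add: nn_integral_eq_integral)
  then have "bochner_norm M p (\<lambda>w. u (f w)) \<le> C * L"
    by (intro bochner_norm_le p CL)
  then show "bochner_norm M p (\<lambda>w. u (f w)) \<le> C * lim ?N"
    using limI[OF L] by simp
qed

section \<open>Continuity of the composition operator\<close>

text \<open>Ensures that the infimum in \<open>psigma_norm\<close> of a difference ranges over a
  nonempty set.\<close>

lemma (in finite_measure) psigma_approximating_diff: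
  fixes f g :: "'a \<Rightarrow> 'b::real_normed_vector"
  assumes p: "1 \<le> p" and f: "weakly_Lp M p f" and g: "weakly_Lp M p g"
    and s: "psigma_approximating M p (1 - 1 / p) s f" and t: "psigma_approximating M p (1 - 1 / p) t g"
  shows "psigma_approximating M p (1 - 1 / p) (\<lambda>n w. s n w - t n w) (\<lambda>w. f w - g w)"
proof -
  let ?N = "simple_psigma_norm M p (1 - 1 / p) :: ('a \<Rightarrow> 'b) \<Rightarrow> real"
  have ss: "simple_function M (s n)" and st: "simple_function M (t n)" for n
    using s t by (auto simp: psigma_approximating_def)
  have swap: "(a - b) - (c - d) = (a - c) - (b - d)" for a b c d :: 'b by simp
  have "\<exists>N. \<forall>m\<ge>N. \<forall>n\<ge>N. ?N (\<lambda>w. (s m w - t m w) - (s n w - t n w)) < \<epsilon>" if "\<epsilon> > 0" for \<epsilon>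
  proof -
    have e2: "\<epsilon> / 2 > 0" using that by simp
    obtain N1 where N1: "\<And>m n. m \<ge> N1 \<Longrightarrow> n \<ge> N1 \<Longrightarrow> ?N (\<lambda>w. s m w - s n w) < \<epsilon> / 2"
      using s e2 unfolding psigma_approximating_def by blast
    obtain N2 where N2: "\<And>m n. m \<ge> N2 \<Longrightarrow> n \<ge> N2 \<Longrightarrow> ?N (\<lambda>w. t m w - t n w) < \<epsilon> / 2"
      using t e2 unfolding psigma_approximating_def by blast
    have "?N (\<lambda>w. (s m w - t m w) - (s n w - t n w)) < \<epsilon>" if "m \<ge> max N1 N2" "n \<ge> max N1 N2" for m n
      using simple_psigma_norm_diff_le[OF p simple_function_compose2[OF ss[of m] ss[of n], of "(-)"]
          simple_function_compose2[OF st[of m] st[of n], of "(-)"]] N1[of m n] N2[of m n] that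
      unfolding swap[of "s m _"] by simp
    then show ?thesis by blast
  qed
  moreover have "(\<lambda>n. pettis_norm M p (\<lambda>w. (s n w - t n w) - (f w - g w))) \<longlonglongrightarrow> 0"
  proof (rule tendsto_sandwich[OF _ _ tendsto_const])
    show "eventually (\<lambda>n. pettis_norm M p (\<lambda>w. (s n w - t n w) - (f w - g w))
        \<le> pettis_norm M p (\<lambda>w. s n w - f w) + pettis_norm M p (\<lambda>w. t n w - g w)) sequentially"
      unfolding swap[of "s _ _"]
      by (intro always_eventually allI pettis_norm_diff_le p weakly_Lp_diff
          simple_function_weakly_Lp ss st f g)
    show "(\<lambda>n. pettis_norm M p (\<lambda>w. s n w - f w) + pettis_norm M p (\<lambda>w. t n w - g w)) \<longlonglongrightarrow> 0"
      using s t unfolding psigma_approximating_def by (auto intro: tendsto_add_zero)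
  qed simp
  ultimately show ?thesis
    unfolding psigma_approximating_def using simple_function_compose2[OF ss st, of "(-)"] by simp
qed

theorem corollary11:
  fixes M :: "'w measure"
    and u :: "'h::{real_inner, complete_space} \<Rightarrow>\<^sub>L 'h"
    and p \<sigma> :: real and p' :: ereal
  assumes "finite_measure M" and "nonatomic M"
    and "1 \<le> p" and "1 / ereal p + 1 / p' = 1" and "ereal \<sigma> = 1 / p'"
    and "approximable (2 * p) u"
  shows "(\<forall>f \<in> psigma_space M p \<sigma>. (\<lambda>w. u (f w)) \<in> bochner_space M p) \<and>
    (\<forall>f \<in> psigma_space M p \<sigma>. \<forall>\<epsilon>>0. \<exists>\<delta>>0. \<forall>g \<in> psigma_space M p \<sigma>.
       psigma_norm M p \<sigma> (\<lambda>w. g w - f w) < \<delta> \<longrightarrow>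
       bochner_norm M p (\<lambda>w. u (g w) - u (f w)) < \<epsilon>)"
proof -
  interpret finite_measure M by fact
  have p: "1 \<le> p" by fact
  \<comment> \<open>The extended real \<open>p'\<close> admits \<open>p = 1\<close>, where
    \<open>p'\<close> is infinite and \<sigma> is 0; in every case the assumptions reduce to this
    real equation.\<close>
  have "ereal (1 / p + \<sigma>) = 1"
    using assms(4) p unfolding assms(5)[symmetric] by (simp add: one_ereal_def)
  then have \<sigma>: "\<sigma> = 1 - 1 / p" by (simp add: one_ereal_def)
  define C where "C = (3 * (sqrt (\<Sum>n. approx_number u (Suc n) powr (2 * p)) + 1)) powr (1 / p)"
  have "0 \<le> suminf (\<lambda>n. approx_number u (Suc n) powr (2 * p))"
    using assms(6) by (intro suminf_nonneg) (auto simp: approximable_def)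
  then have "sqrt (\<Sum>n. approx_number u (Suc n) powr (2 * p)) + 1 > 0" by (simp add: add_nonneg_pos)
  then have C0: "C > 0" unfolding C_def by simp
  have space: "weakly_Lp M p f" "\<exists>s. psigma_approximating M p (1 - 1 / p) s f"
    if "f \<in> psigma_space M p \<sigma>" for f :: "'w \<Rightarrow> 'h"
    using that pettis_space_weakly_Lp by (auto simp: psigma_space_def \<sigma>)
  have "(\<lambda>w. u (f w)) \<in> bochner_space M p" if "f \<in> psigma_space M p \<sigma>" for f
    using space[OF that] comp_in_bochner_space[OF p assms(6)] by blast
  moreover have "\<exists>\<delta>>0. \<forall>g \<in> psigma_space M p \<sigma>. psigma_norm M p \<sigma> (\<lambda>w. g w - f w) < \<delta> \<longrightarrow>
       bochner_norm M p (\<lambda>w. u (g w) - u (f w)) < \<epsilon>"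
    if f: "f \<in> psigma_space M p \<sigma>" and "\<epsilon> > 0" for f \<epsilon>
  \<comment> \<open>By linearity the bound applies to \<open>g - f\<close> with constant
    \<open>C\<close>, so this \<delta> serves every \<open>f\<close>.\<close>
  proof (intro exI[of _ "\<epsilon> / C"] conjI ballI impI)
    show "\<epsilon> / C > 0" using C0 \<open>\<epsilon> > 0\<close> by simp
    fix g assume g: "g \<in> psigma_space M p \<sigma>"
      and less: "psigma_norm M p \<sigma> (\<lambda>w. g w - f w) < \<epsilon> / C"
    let ?h = "\<lambda>w. g w - f w"
    have h: "weakly_Lp M p ?h" by (intro weakly_Lp_diff p space f g)
    have "\<exists>s. psigma_approximating M p (1 - 1 / p) s ?h"
      using psigma_approximating_diff[OF p space(1)[OF g] space(1)[OF f]] space(2)[OF f] space(2)[OF g]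
      by blast
    then have "{lim (\<lambda>n. simple_psigma_norm M p (1 - 1 / p) (s n)) | s.
        psigma_approximating M p (1 - 1 / p) s ?h} \<noteq> {}" by blast
    \<comment> \<open>The infimum need not be attained, but lying below
      \<open>\<epsilon> / C\<close> it provides one approximating sequence whose limit also
      does.\<close>
    from cInf_lessD[OF this] less obtain s where s: "psigma_approximating M p (1 - 1 / p) s ?h"
      and lim: "lim (\<lambda>n. simple_psigma_norm M p (1 - 1 / p) (s n)) < \<epsilon> / C"
      unfolding psigma_norm_def \<sigma> by blast
    have "bochner_norm M p (\<lambda>w. u (g w) - u (f w)) = bochner_norm M p (\<lambda>w. u (?h w))"
      by (simp add: blinfun.diff_right)
    also have "\<dots> \<le> C * lim (\<lambda>n. simple_psigma_norm M p (1 - 1 / p) (s n))"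
      by (rule bochner_norm_comp_le[OF p assms(6) h s C_def])
    also have "\<dots> < \<epsilon>" using lim C0 by (simp add: less_divide_eq mult.commute)
    finally show "bochner_norm M p (\<lambda>w. u (g w) - u (f w)) < \<epsilon>" .
  qed
  ultimately show ?thesis by blast
qed

end
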